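(* For any bounded deterministic matrices $A_1,A_2\in\mathbb{C}^{2n\times2n}$ we have $$\|M_{12}^{A_1}\|\lesssim\frac1\gamma,\qquad \big|\langle\widehat M_{12}^{A_1}A_2\rangle\big|\lesssim\frac{\rho_1\rho_2}{\widehat\gamma},\qquad \|M_{121}^{A_1,A_2}\|\lesssim\frac{1}{\eta_*\gamma},$$ uniformly for any $z_1,z_2\in\mathbb{C}$ with $|z_i|<10$ and any $\eta_1,\eta_2\in\mathbb{R}$ with $0<|\eta_i|<10$. Here $\eta_*=\min_{i=1,2}|\eta_i|$, $\rho_i=\pi^{-1}|\Im m^{z_i}(\mathrm{i}\eta_i)|$, the matrices $M_{12}^{A_1},\widehat M_{12}^{A_1},M_{121}^{A_1,A_2}$ (defined in the context) are evaluated at $(\mathrm{i}\eta_1,z_1,\mathrm{i}\eta_2,z_2)$, and $$\widehat\gamma=|z_1-z_2|^2+\rho_1|\eta_1|+\rho_2|\eta_2|+\Big(\frac{\eta_1}{\rho_1}\Big)^2+\Big(\frac{\eta_2}{\rho_2}\Big)^2,\qquad \gamma=\frac{\widehat\gamma}{|z_1-z_2|+\rho_1^2+\rho_2^2+\frac{|\eta_1|}{\rho_1}+\frac{|\eta_2|}{\rho_2}} .$$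
   Context: For $z\in\mathbb{C}$, $w\in\mathbb{C}\setminus\mathbb{R}$, $m^z(w)$ is the unique solution of $-\frac{1}{m^z(w)}=w+m^z(w)-\frac{|z|^2}{w+m^z(w)}$ with $\Im m^z(w)\,\Im w>0$; $u^z(w)=\frac{m^z(w)}{w+m^z(w)}$; and $$M^z(w)=\begin{pmatrix}m^z(w)I_n&-zu^z(w)I_n\\-\overline z u^z(w)I_n&m^z(w)I_n\end{pmatrix}\in\mathbb{C}^{2n\times2n}.$$ $\langle A\rangle=(2n)^{-1}\mathrm{Tr}A$ for $A\in\mathbb{C}^{2n\times2n}$; $E_+=\mathrm{diag}(I_n,I_n)$, $E_-=\mathrm{diag}(I_n,-I_n)$; $\mathcal{S}[R]=\langle RE_+\rangle E_+-\langle RE_-\rangle E_-$. Write $M_i=M^{z_i}(\mathrm{i}\eta_i)$, $\mathcal{B}_{ij}[R]=R-M_i\mathcal{S}[R]M_j$, and set $$M_{ij}^{A}=\mathcal{B}_{ij}^{-1}[M_iAM_j],\qquad M_{121}^{A_1,A_2}=\mathcal{B}_{11}^{-1}\big[M_1A_1M_{21}^{A_2}+M_1\mathcal{S}[M_{12}^{A_1}]M_{21}^{A_2}\big].$$ Writing $M_{12}^A(\mathrm{i}\eta_1,z_1,\mathrm{i}\eta_2,z_2)$ for the dependence on parameters, $$\widehat M_{12}^{A}=\tfrac14\big(M_{12}^A(\mathrm{i}\eta_1,z_1,-\mathrm{i}\eta_2,z_2)+M_{12}^A(-\mathrm{i}\eta_1,z_1,\mathrm{i}\eta_2,z_2)-M_{12}^A(\mathrm{i}\eta_1,z_1,\mathrm{i}\eta_2,z_2)-M_{12}^A(-\mathrm{i}\eta_1,z_1,-\mathrm{i}\eta_2,z_2)\big).$$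 Matrix norms are operator norms induced by the Euclidean norm; "bounded" means $\|A_i\|\lesssim1$; $f\lesssim g$ means $f\le Cg$ with a constant $C$ independent of $n$ and of the parameters over which uniformity is claimed. *)

theory Defs
  imports "HOL-Analysis.L2_Norm" "Jordan_Normal_Form.Matrix"
begin

text \<open>
  Matrices are taken from Jordan_Normal_Form, so that the size \<open>n\<close> is an ordinary natural number
  and uniformity in \<open>n\<close> can be expressed inside the formula. Throughout, \<open>2n \<times> 2n\<close> matrices are
  the elements of \<open>carrier_mat (2 * n) (2 * n)\<close>.
\<close>

definition vec_l2 :: "complex vec \<Rightarrow> real" where
  "vec_l2 v = L2_set (\<lambda>i. cmod (v $ i)) {..<dim_vec v}"

definition op_norm :: "complex mat \<Rightarrow> real" where
  "op_norm A = (SUP v \<in> {v \<in> carrier_vec (dim_col A). vec_l2 v \<le> 1}. vec_l2 (A *\<^sub>v v))"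

definition ntrace :: "nat \<Rightarrow> complex mat \<Rightarrow> complex" where
  "ntrace n A = (\<Sum>i<2 * n. A $$ (i, i)) / of_nat (2 * n)"

definition E_plus :: "nat \<Rightarrow> complex mat" where
  "E_plus n = four_block_mat (1\<^sub>m n) (0\<^sub>m n n) (0\<^sub>m n n) (1\<^sub>m n)"

definition E_minus :: "nat \<Rightarrow> complex mat" where
  "E_minus n = four_block_mat (1\<^sub>m n) (0\<^sub>m n n) (0\<^sub>m n n) (- 1\<^sub>m n)"

text \<open>
  The sign condition makes \<open>m\<close> and \<open>w + m\<close> nonzero, so totalised division plays no role in the
  defining equation.
\<close>

definition m_sol :: "complex \<Rightarrow> complex \<Rightarrow> complex" where
  "m_sol z w = (THE m. - 1 / m = w + m - of_real ((cmod z)\<^sup>2) / (w + m) \<and> Im m * Im w > 0)"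

definition u_sol :: "complex \<Rightarrow> complex \<Rightarrow> complex" where
  "u_sol z w = m_sol z w / (w + m_sol z w)"

definition M_mat :: "nat \<Rightarrow> complex \<Rightarrow> complex \<Rightarrow> complex mat" where
  "M_mat n z w = four_block_mat
     (m_sol z w \<cdot>\<^sub>m 1\<^sub>m n)               ((- z * u_sol z w) \<cdot>\<^sub>m 1\<^sub>m n)
     ((- cnj z * u_sol z w) \<cdot>\<^sub>m 1\<^sub>m n)  (m_sol z w \<cdot>\<^sub>m 1\<^sub>m n)"

definition S_op :: "nat \<Rightarrow> complex mat \<Rightarrow> complex mat" where
  "S_op n R = ntrace n (R * E_plus n) \<cdot>\<^sub>m E_plus n - ntrace n (R * E_minus n) \<cdot>\<^sub>m E_minus n"

text \<open>The operator \<open>\<B>\<^sub>i\<^sub>j\<close> for \<open>M\<^sub>i = P\<close> and \<open>M\<^sub>j = Q\<close>.\<close>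

definition B_op :: "nat \<Rightarrow> complex mat \<Rightarrow> complex mat \<Rightarrow> complex mat \<Rightarrow> complex mat" where
  "B_op n P Q R = R - P * S_op n R * Q"

definition B_inv :: "nat \<Rightarrow> complex mat \<Rightarrow> complex mat \<Rightarrow> complex mat \<Rightarrow> complex mat" where
  "B_inv n P Q = inv_into (carrier_mat (2 * n) (2 * n)) (B_op n P Q)"

text \<open>
  Argument order as in \<open>M\<^sub>1\<^sub>2\<^sup>A(w\<^sub>1, z\<^sub>1, w\<^sub>2, z\<^sub>2)\<close>; \<open>M\<^sub>2\<^sub>1\<^sup>A\<close> is obtained by exchanging the index pairs.
\<close>

definition M12 ::
  "nat \<Rightarrow> complex \<Rightarrow> complex \<Rightarrow> complex \<Rightarrow> complex \<Rightarrow> complex mat \<Rightarrow> complex mat" where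
  "M12 n w1 z1 w2 z2 A =
     B_inv n (M_mat n z1 w1) (M_mat n z2 w2) (M_mat n z1 w1 * A * M_mat n z2 w2)"

definition M121 ::
  "nat \<Rightarrow> complex \<Rightarrow> complex \<Rightarrow> complex \<Rightarrow> complex \<Rightarrow> complex mat \<Rightarrow> complex mat \<Rightarrow> complex mat" where
  "M121 n w1 z1 w2 z2 A1 A2 =
     B_inv n (M_mat n z1 w1) (M_mat n z1 w1)
       (M_mat n z1 w1 * A1 * M12 n w2 z2 w1 z1 A2
        + M_mat n z1 w1 * S_op n (M12 n w1 z1 w2 z2 A1) * M12 n w2 z2 w1 z1 A2)"

definition M12_hat ::
  "nat \<Rightarrow> real \<Rightarrow> complex \<Rightarrow> real \<Rightarrow> complex \<Rightarrow> complex mat \<Rightarrow> complex mat" where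
  "M12_hat n \<eta>1 z1 \<eta>2 z2 A = (1 / 4) \<cdot>\<^sub>m
     (M12 n (\<i> * of_real \<eta>1) z1 (- \<i> * of_real \<eta>2) z2 A
      + M12 n (- \<i> * of_real \<eta>1) z1 (\<i> * of_real \<eta>2) z2 A
      - M12 n (\<i> * of_real \<eta>1) z1 (\<i> * of_real \<eta>2) z2 A
      - M12 n (- \<i> * of_real \<eta>1) z1 (- \<i> * of_real \<eta>2) z2 A)"

definition rho :: "complex \<Rightarrow> real \<Rightarrow> real" where
  "rho z \<eta> = \<bar>Im (m_sol z (\<i> * of_real \<eta>))\<bar> / pi"

definition gamma_hat :: "real \<Rightarrow> complex \<Rightarrow> real \<Rightarrow> complex \<Rightarrow> real" where
  "gamma_hat \<eta>1 z1 \<eta>2 z2 =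
     (cmod (z1 - z2))\<^sup>2 + rho z1 \<eta>1 * \<bar>\<eta>1\<bar> + rho z2 \<eta>2 * \<bar>\<eta>2\<bar>
     + (\<eta>1 / rho z1 \<eta>1)\<^sup>2 + (\<eta>2 / rho z2 \<eta>2)\<^sup>2"

definition gamma_ctrl :: "real \<Rightarrow> complex \<Rightarrow> real \<Rightarrow> complex \<Rightarrow> real" where
  "gamma_ctrl \<eta>1 z1 \<eta>2 z2 = gamma_hat \<eta>1 z1 \<eta>2 z2 /
     (cmod (z1 - z2) + (rho z1 \<eta>1)\<^sup>2 + (rho z2 \<eta>2)\<^sup>2
      + \<bar>\<eta>1\<bar> / rho z1 \<eta>1 + \<bar>\<eta>2\<bar> / rho z2 \<eta>2)"

end

theory Submission
  imports Defs
begin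

text \<open>
  On the imaginary axis \<open>m = \<i> v\<close> with \<open>v\<close> real. Since \<open>S_op\<close> only sees the normalised traces of the
  two diagonal blocks, inverting \<open>B_op\<close> means solving a 2 by 2 linear system, whose determinant is
  \<open>\<beta> = u1 u2 |z1 - z2|\<^sup>2 + (1 - u1) (1 - u2) + u2 |v1 \<eta>1| + u1 |v2 \<eta>2|\<close> with \<open>u = v / (\<eta> + v)\<close>, a sum of
  positive terms that is bounded below by a multiple of \<open>gamma_hat\<close>. The entries of the adjugate
  are \<open>O(gamma_hat / gamma)\<close>, which is the first bound. Changing the sign of \<open>\<eta>\<close> changes the sign of \<open>v\<close>
  and nothing else, so the part of \<open>M12\<close> odd in both signs carries a factor \<open>v1 v2\<close>: the second
  bound. For \<open>M121\<close> the product of the first bounds is too large by itself. It is applied to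
  \<open>M1 (A1 + S[M12]) M2 (A2 + S[M21]) M1\<close>, and by cyclicity the traces against \<open>E_minus\<close> and
  \<open>E_plus\<close> involve \<open>M1 E_minus M1 = - u1 E_minus\<close> and \<open>M1 M1\<close>. In the first of them the terms
  quadratic in \<open>1 / \<beta>\<close> cancel; in the second they carry a factor \<open>|v1| + |v2|\<close>, which is small enough.
\<close>

section \<open>Operator norm and traces of block matrices\<close>

text \<open>The lower bound on the determinant has one gap: \<open>\<beta>\<close> contains only the
  product \<open>(1 - u1) (1 - u2)\<close>, whereas \<open>gamma_hat\<close> contains
  \<open>(\<eta> / rho)\<^sup>2\<close>, which is comparable to \<open>(1 - u)\<^sup>2\<close>, for
  each index separately. The missing squares come from the scalar equations, which tie
  \<open>u1\<close>, \<open>v1\<close> to \<open>u2\<close>, \<open>v2\<close> through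
  \<open>|z1|\<^sup>2 - |z2|\<^sup>2\<close>. For \<open>M121\<close>, two factors
  \<open>1 / gamma_ctrl\<close> are present before the outer operator is inverted. One of them can
  be exchanged for the inverse of the smaller \<open>|\<eta>|\<close>, but nothing is then left to
  pay for the inversion. That inversion is diagonal in the sum and the difference of the two block
  traces, with eigenvalues \<open>1 - u1 + 2 v1\<^sup>2\<close> and \<open>1 - u1\<close>, so
  exactly two traces need a better estimate. The number 221 that recurs in the constants comes from
  \<open>u \<ge> 1 / 221\<close> on the whole parameter range; powers of ten are roundings.\<close>

lemma vec_l2_nonneg [simp]: "0 \<le> vec_l2 v"
  by (simp add: vec_l2_def)

lemma vec_l2_zero_vec [simp]: "vec_l2 (0\<^sub>v k) = 0"
  by (auto simp: vec_l2_def L2_set_def)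

lemma vec_l2_eq_0D: "vec_l2 v = 0 \<Longrightarrow> v = 0\<^sub>v (dim_vec v)"
  by (auto simp: vec_l2_def L2_set_eq_0_iff)

lemma vec_l2_smult: "vec_l2 (c \<cdot>\<^sub>v v) = cmod c * vec_l2 v"
proof -
  have "vec_l2 (c \<cdot>\<^sub>v v) = L2_set (\<lambda>i. cmod c * cmod (v $ i)) {..<dim_vec v}"
    unfolding vec_l2_def by (auto intro!: L2_set_cong simp: norm_mult)
  then show ?thesis
    by (simp add: vec_l2_def L2_set_right_distrib)
qed

lemma vec_l2_add:
  assumes "dim_vec v = dim_vec w"
  shows "vec_l2 (v + w) \<le> vec_l2 v + vec_l2 w"
proof -
  have "vec_l2 (v + w) \<le> L2_set (\<lambda>i. cmod (v $ i) + cmod (w $ i)) {..<dim_vec w}"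
    unfolding vec_l2_def using assms by (auto intro!: L2_set_mono norm_triangle_ineq)
  also have "\<dots> \<le> vec_l2 v + vec_l2 w"
    unfolding vec_l2_def assms by (rule L2_set_triangle_ineq)
  finally show ?thesis .
qed

lemma cmod_index_le_vec_l2: "i < dim_vec v \<Longrightarrow> cmod (v $ i) \<le> vec_l2 v"
  unfolding vec_l2_def by (rule member_le_L2_set) auto

text \<open>The sum of the moduli of all entries is a crude bound that grows with the size. It
  serves to show that the supremum in \<open>op_norm\<close> is over a bounded set, without which a
  real \<open>SUP\<close> carries no information.\<close>

lemma mult_mat_vec_bounded:
  obtains B where "0 \<le> B"
    "\<And>v. v \<in> carrier_vec (dim_col A) \<Longrightarrow> vec_l2 (A *\<^sub>v v) \<le> B * vec_l2 v"
proof
  define B where "B = (\<Sum>i<dim_row A. \<Sum>j<dim_col A. cmod (A $$ (i, j)))"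
  show "0 \<le> B" by (auto simp: B_def intro!: sum_nonneg)
  fix v :: "complex vec" assume v: "v \<in> carrier_vec (dim_col A)"
  have "vec_l2 (A *\<^sub>v v) \<le> (\<Sum>i<dim_row A. cmod ((A *\<^sub>v v) $ i))"
    unfolding vec_l2_def using L2_set_le_sum[of "{..<dim_row A}" "\<lambda>i. cmod ((A *\<^sub>v v) $ i)"] by simp
  also have "\<dots> \<le> (\<Sum>i<dim_row A. \<Sum>j<dim_col A. cmod (A $$ (i, j)) * vec_l2 v)"
  proof (rule sum_mono)
    fix i assume i: "i \<in> {..<dim_row A}"
    have "(A *\<^sub>v v) $ i = (\<Sum>j<dim_col A. A $$ (i, j) * v $ j)"
      using i v by (auto simp: scalar_prod_def lessThan_atLeast0 intro!: sum.cong)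
    also have "cmod \<dots> \<le> (\<Sum>j<dim_col A. cmod (A $$ (i, j) * v $ j))" by (rule norm_sum)
    also have "\<dots> \<le> (\<Sum>j<dim_col A. cmod (A $$ (i, j)) * vec_l2 v)"
      using v by (auto simp: norm_mult intro!: sum_mono mult_left_mono cmod_index_le_vec_l2)
    finally show "cmod ((A *\<^sub>v v) $ i) \<le> \<dots>" .
  qed
  also have "\<dots> = B * vec_l2 v" by (simp add: B_def sum_distrib_right)
  finally show "vec_l2 (A *\<^sub>v v) \<le> B * vec_l2 v" .
qed

lemma op_norm_bdd: "bdd_above ((\<lambda>v. vec_l2 (A *\<^sub>v v)) ` {v \<in> carrier_vec (dim_col A). vec_l2 v \<le> 1})"
proof -
  obtain B where B: "0 \<le> B"
    "\<And>v. v \<in> carrier_vec (dim_col A) \<Longrightarrow> vec_l2 (A *\<^sub>v v) \<le> B * vec_l2 v"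
    using mult_mat_vec_bounded by metis
  have "vec_l2 (A *\<^sub>v v) \<le> B" if "v \<in> carrier_vec (dim_col A)" "vec_l2 v \<le> 1" for v
    using B(2)[OF that(1)] mult_left_mono[OF that(2) B(1)] by simp
  then show ?thesis by (auto intro!: bdd_aboveI[of _ B])
qed

lemma op_norm_nonneg [simp]: "0 \<le> op_norm A"
proof -
  have "vec_l2 (A *\<^sub>v 0\<^sub>v (dim_col A)) \<le> op_norm A"
    unfolding op_norm_def by (rule cSUP_upper[OF _ op_norm_bdd]) auto
  then show ?thesis using vec_l2_nonneg order_trans by blast
qed

lemma vec_l2_mult_mat_vec_le:
  assumes v: "v \<in> carrier_vec (dim_col A)"
  shows "vec_l2 (A *\<^sub>v v) \<le> op_norm A * vec_l2 v"
proof (cases "vec_l2 v = 0")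
  case True
  then have "v = 0\<^sub>v (dim_col A)" using vec_l2_eq_0D[of v] v by simp
  moreover have "A *\<^sub>v 0\<^sub>v (dim_col A) = 0\<^sub>v (dim_row A)" by auto
  ultimately show ?thesis by simp
next
  case False
  define c where "c = vec_l2 v"
  have c: "c > 0" using False vec_l2_nonneg[of v] unfolding c_def by linarith
  let ?w = "of_real (1 / c) \<cdot>\<^sub>v v"
  have "vec_l2 (A *\<^sub>v ?w) \<le> op_norm A"
    unfolding op_norm_def using c v
    by (intro cSUP_upper[OF _ op_norm_bdd]) (auto simp: vec_l2_smult c_def norm_divide)
  moreover have "A *\<^sub>v ?w = of_real (1 / c) \<cdot>\<^sub>v (A *\<^sub>v v)" using v by (intro mult_mat_vec) auto
  ultimately show ?thesis using c
    by (simp add: vec_l2_smult c_def norm_divide field_simps)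
qed

lemma op_norm_leI:
  assumes "0 \<le> c" "\<And>v. v \<in> carrier_vec (dim_col A) \<Longrightarrow> vec_l2 (A *\<^sub>v v) \<le> c * vec_l2 v"
  shows "op_norm A \<le> c"
  unfolding op_norm_def
proof (rule cSUP_least)
  show "{v \<in> carrier_vec (dim_col A). vec_l2 v \<le> 1} \<noteq> {}"
    by (auto intro!: exI[of _ "0\<^sub>v (dim_col A)"])
  fix v assume "v \<in> {v \<in> carrier_vec (dim_col A). vec_l2 v \<le> 1}"
  then show "vec_l2 (A *\<^sub>v v) \<le> c"
    using assms(2)[of v] mult_left_mono[of "vec_l2 v" 1 c] assms(1) by auto
qed

lemma op_norm_mult:
  assumes A: "A \<in> carrier_mat r k" and B: "B \<in> carrier_mat k c"
  shows "op_norm (A * B) \<le> op_norm A * op_norm B"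
proof (rule op_norm_leI)
  show "0 \<le> op_norm A * op_norm B" by simp
  fix v :: "complex vec" assume "v \<in> carrier_vec (dim_col (A * B))"
  then have v: "v \<in> carrier_vec c" using B by auto
  have "vec_l2 ((A * B) *\<^sub>v v) = vec_l2 (A *\<^sub>v (B *\<^sub>v v))" using A B v by simp
  also have "\<dots> \<le> op_norm A * vec_l2 (B *\<^sub>v v)"
    using A B v by (intro vec_l2_mult_mat_vec_le) auto
  also have "\<dots> \<le> op_norm A * (op_norm B * vec_l2 v)"
    using B v by (intro mult_left_mono vec_l2_mult_mat_vec_le) auto
  finally show "vec_l2 ((A * B) *\<^sub>v v) \<le> op_norm A * op_norm B * vec_l2 v" by (simp add: mult.assoc)
qed

lemma op_norm_add:
  assumes A: "A \<in> carrier_mat r c" and B: "B \<in> carrier_mat r c"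
  shows "op_norm (A + B) \<le> op_norm A + op_norm B"
proof (rule op_norm_leI)
  show "0 \<le> op_norm A + op_norm B" by simp
  fix v :: "complex vec" assume "v \<in> carrier_vec (dim_col (A + B))"
  then have v: "v \<in> carrier_vec c" using B by auto
  have "vec_l2 ((A + B) *\<^sub>v v) = vec_l2 (A *\<^sub>v v + B *\<^sub>v v)"
    using add_mult_distrib_mat_vec[OF A B v] by simp
  also have "\<dots> \<le> vec_l2 (A *\<^sub>v v) + vec_l2 (B *\<^sub>v v)"
    using A B by (intro vec_l2_add) auto
  also have "\<dots> \<le> op_norm A * vec_l2 v + op_norm B * vec_l2 v"
    using A B v by (intro add_mono vec_l2_mult_mat_vec_le) auto
  finally show "vec_l2 ((A + B) *\<^sub>v v) \<le> (op_norm A + op_norm B) * vec_l2 v"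
    by (simp only: distrib_right)
qed

lemma cmod_index_le_op_norm:
  assumes "i < dim_row A" "j < dim_col A"
  shows "cmod (A $$ (i, j)) \<le> op_norm A"
proof -
  have e: "vec_l2 (unit_vec (dim_col A) j) = 1"
  proof -
    have "vec_l2 (unit_vec (dim_col A) j) = sqrt (\<Sum>i<dim_col A. if i = j then 1 else 0)"
      unfolding vec_l2_def L2_set_def using assms
      by (intro arg_cong[of _ _ sqrt] sum.cong) auto
    also have "\<dots> = 1" using assms by (subst sum.delta) auto
    finally show ?thesis .
  qed
  have "A $$ (i, j) = (A *\<^sub>v unit_vec (dim_col A) j) $ i"
    using assms by simp
  also have "cmod \<dots> \<le> vec_l2 (A *\<^sub>v unit_vec (dim_col A) j)"
    using assms by (intro cmod_index_le_vec_l2) auto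
  also have "\<dots> \<le> op_norm A" using vec_l2_mult_mat_vec_le[of "unit_vec (dim_col A) j" A] e by auto
  finally show ?thesis .
qed

section \<open>Normalised traces and matrices with scalar blocks\<close>

abbreviation cmat :: "nat \<Rightarrow> complex mat set" where
  "cmat n \<equiv> carrier_mat (2 * n) (2 * n)"

text \<open>The normalised trace averages diagonal entries, each at most the operator norm, so no
  factor \<open>n\<close> appears. For \<open>n = 0\<close> the quotient is \<open>0\<close> by
  convention.\<close>

lemma cmod_ntrace_le:
  assumes A: "A \<in> cmat n"
  shows "cmod (ntrace n A) \<le> op_norm A"
proof (cases "n = 0")
  case True then show ?thesis by (simp add: ntrace_def)
next
  case False
  have "cmod (\<Sum>i<2 * n. A $$ (i, i)) \<le> (\<Sum>i<2 * n. op_norm A)"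
    using A by (intro sum_norm_le cmod_index_le_op_norm) auto
  then show ?thesis using False by (simp add: ntrace_def norm_divide norm_mult field_simps)
qed

lemma ntrace_add: "A \<in> cmat n \<Longrightarrow> B \<in> cmat n \<Longrightarrow> ntrace n (A + B) = ntrace n A + ntrace n B"
  by (simp add: ntrace_def sum.distrib add_divide_distrib)

lemma ntrace_minus: "A \<in> cmat n \<Longrightarrow> B \<in> cmat n \<Longrightarrow> ntrace n (A - B) = ntrace n A - ntrace n B"
  by (simp add: ntrace_def sum_subtractf diff_divide_distrib)

lemma ntrace_smult: "A \<in> cmat n \<Longrightarrow> ntrace n (c \<cdot>\<^sub>m A) = c * ntrace n A"
  by (simp add: ntrace_def sum_distrib_left)

lemma ntrace_mult_commute:
  assumes A: "A \<in> cmat n" and B: "B \<in> cmat n"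
  shows "ntrace n (A * B) = ntrace n (B * A)"
proof -
  have "(\<Sum>i<2 * n. (A * B) $$ (i, i)) = (\<Sum>i<2 * n. \<Sum>j<2 * n. A $$ (i, j) * B $$ (j, i))"
    using A B by (auto simp: scalar_prod_def lessThan_atLeast0 intro!: sum.cong)
  also have "\<dots> = (\<Sum>j<2 * n. \<Sum>i<2 * n. B $$ (j, i) * A $$ (i, j))"
    by (subst sum.swap) (simp add: mult.commute)
  also have "\<dots> = (\<Sum>i<2 * n. (B * A) $$ (i, i))"
    using A B by (auto simp: scalar_prod_def lessThan_atLeast0 intro!: sum.cong)
  finally show ?thesis by (simp add: ntrace_def)
qed

text \<open>These matrices add and multiply like 2 by 2 complex matrices. \<open>M_mat\<close>,
  \<open>E_plus\<close>, \<open>E_minus\<close> and all values of \<open>S_op\<close> have this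
  form, which is why products and norm bounds do not see \<open>n\<close>.\<close>

definition blk :: "nat \<Rightarrow> complex \<Rightarrow> complex \<Rightarrow> complex \<Rightarrow> complex \<Rightarrow> complex mat" where
  "blk n a b c d =
     four_block_mat (a \<cdot>\<^sub>m 1\<^sub>m n) (b \<cdot>\<^sub>m 1\<^sub>m n) (c \<cdot>\<^sub>m 1\<^sub>m n) (d \<cdot>\<^sub>m 1\<^sub>m n)"

lemma blk_carrier [simp]: "blk n a b c d \<in> cmat n"
  by (auto simp: blk_def mult_2)

lemma blk_mult [simp]:
  "blk n a b c d * blk n a' b' c' d' =
     blk n (a * a' + b * c') (a * b' + b * d') (c * a' + d * c') (c * b' + d * d')"
proof -
  have s: "x \<cdot>\<^sub>m 1\<^sub>m n * (y \<cdot>\<^sub>m 1\<^sub>m n) = (x * y) \<cdot>\<^sub>m (1\<^sub>m n :: complex mat)" for x y :: complex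
    by (rule eq_matI) auto
  have a: "x \<cdot>\<^sub>m 1\<^sub>m n + y \<cdot>\<^sub>m 1\<^sub>m n = (x + y) \<cdot>\<^sub>m (1\<^sub>m n :: complex mat)" for x y :: complex
    by (rule eq_matI) auto
  show ?thesis
    unfolding blk_def
    by (subst mult_four_block_mat[of _ n n _ n _ n _ _ n _ n]) (auto simp: s a)
qed

lemma blk_add [simp]:
  "blk n a b c d + blk n a' b' c' d' = blk n (a + a') (b + b') (c + c') (d + d')"
  by (rule eq_matI) (auto simp: blk_def)

lemma blk_minus [simp]:
  "blk n a b c d - blk n a' b' c' d' = blk n (a - a') (b - b') (c - c') (d - d')"
  by (rule eq_matI) (auto simp: blk_def)

lemma smult_blk [simp]: "x \<cdot>\<^sub>m blk n a b c d = blk n (x * a) (x * b) (x * c) (x * d)"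
  by (rule eq_matI) (auto simp: blk_def)

lemma E_plus_blk: "E_plus n = blk n 1 0 0 1"
  unfolding E_plus_def blk_def by (rule cong_four_block_mat) auto

lemma E_minus_blk: "E_minus n = blk n 1 0 0 (-1)"
  unfolding E_minus_def blk_def by (rule cong_four_block_mat) auto

lemma ntrace_blk:
  assumes "n \<ge> 1"
  shows "ntrace n (blk n a b c d) = (a + d) / 2"
proof -
  have "(\<Sum>i<2 * n. blk n a b c d $$ (i, i)) = (\<Sum>i<2 * n. if i < n then a else d)"
    by (intro sum.cong) (auto simp: blk_def)
  also have "\<dots> = (\<Sum>i<n. a) + (\<Sum>i\<in>{n..<2 * n}. d)"
  proof -
    have "{..<2 * n} = {..<n} \<union> {n..<2 * n}" by auto
    then show ?thesis by (simp add: sum.union_disjoint disjoint_iff)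
  qed
  also have "\<dots> = of_nat n * (a + d)" by (simp add: distrib_left)
  finally show ?thesis using assms by (simp add: ntrace_def)
qed

lemma vec_l2_append_le:
  "vec_l2 (v @\<^sub>v w) \<le> vec_l2 v + vec_l2 w" (is ?A)
  "vec_l2 v \<le> vec_l2 (v @\<^sub>v w)" (is ?B)
  "vec_l2 w \<le> vec_l2 (v @\<^sub>v w)" (is ?C)
proof -
  let ?n = "dim_vec v" and ?m = "dim_vec w"
  have "(\<Sum>i<?n + k. (cmod ((v @\<^sub>v w) $ i))\<^sup>2)
    = (\<Sum>i<?n. (cmod (v $ i))\<^sup>2) + (\<Sum>i<k. (cmod (w $ i))\<^sup>2)" if "k \<le> ?m" for k
    using that by (induction k) auto
  from this[of ?m]
  have sq: "(vec_l2 (v @\<^sub>v w))\<^sup>2 = (vec_l2 v)\<^sup>2 + (vec_l2 w)\<^sup>2"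
    unfolding vec_l2_def L2_set_def by (simp add: sum_nonneg)
  show ?A by (rule power2_le_imp_le) (simp_all add: sq power2_sum)
  show ?B by (rule power2_le_imp_le) (simp_all add: sq)
  show ?C by (rule power2_le_imp_le) (simp_all add: sq)
qed

lemma op_norm_blk: "op_norm (blk n a b c d) \<le> cmod a + cmod b + cmod c + cmod d"
proof (rule op_norm_leI)
  fix v :: "complex vec" assume "v \<in> carrier_vec (dim_col (blk n a b c d))"
  then have v: "v \<in> carrier_vec (n + n)" using blk_carrier[of n a b c d] by (auto simp: mult_2)
  define p q where "p = vec_first v n" and "q = vec_last v n"
  have pq: "p \<in> carrier_vec n" "q \<in> carrier_vec n" "v = p @\<^sub>v q"
    using v by (auto simp: p_def q_def)
  have sm: "(x \<cdot>\<^sub>m 1\<^sub>m n) *\<^sub>v y = x \<cdot>\<^sub>v y" if "y \<in> carrier_vec n" for x :: complex and y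
    using that by (intro eq_vecI) auto
  have "blk n a b c d *\<^sub>v v = (a \<cdot>\<^sub>v p + b \<cdot>\<^sub>v q) @\<^sub>v (c \<cdot>\<^sub>v p + d \<cdot>\<^sub>v q)"
    unfolding blk_def pq(3) using pq(1,2)
    by (subst four_block_mat_mult_vec[of _ n n _ n _ n]) (auto simp: sm)
  then have "vec_l2 (blk n a b c d *\<^sub>v v) \<le> vec_l2 (a \<cdot>\<^sub>v p + b \<cdot>\<^sub>v q) + vec_l2 (c \<cdot>\<^sub>v p + d \<cdot>\<^sub>v q)"
    by (simp add: vec_l2_append_le)
  also have "\<dots> \<le> (cmod a * vec_l2 p + cmod b * vec_l2 q) + (cmod c * vec_l2 p + cmod d * vec_l2 q)"
    using pq(1,2) vec_l2_add[of "a \<cdot>\<^sub>v p" "b \<cdot>\<^sub>v q"] vec_l2_add[of "c \<cdot>\<^sub>v p" "d \<cdot>\<^sub>v q"]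
    by (auto simp: vec_l2_smult)
  also have "\<dots> \<le> (cmod a * vec_l2 v + cmod b * vec_l2 v) + (cmod c * vec_l2 v + cmod d * vec_l2 v)"
    unfolding pq(3) by (intro add_mono mult_left_mono vec_l2_append_le) auto
  finally show "vec_l2 (blk n a b c d *\<^sub>v v) \<le> (cmod a + cmod b + cmod c + cmod d) * vec_l2 v"
    by (simp only: distrib_right add.assoc)
qed simp

text \<open>\<open>btr1\<close> and \<open>btr2\<close> are the traces of the upper left and lower
  right blocks divided by \<open>n\<close>: combining the traces against \<open>E_plus\<close> and
  \<open>E_minus\<close> keeps one block twice.\<close>

definition btr1 :: "nat \<Rightarrow> complex mat \<Rightarrow> complex" where
  "btr1 n X = ntrace n (X * E_plus n) + ntrace n (X * E_minus n)"

definition btr2 :: "nat \<Rightarrow> complex mat \<Rightarrow> complex" where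
  "btr2 n X = ntrace n (X * E_plus n) - ntrace n (X * E_minus n)"

text \<open>The minus sign in front of \<open>E_minus\<close> exchanges the blocks: the lower trace
  lands in the upper block. Hence the order \<open>x2\<close>, \<open>x1\<close> in every later
  \<open>blk n x2 0 0 x1\<close>.\<close>

lemma S_op_blk: "S_op n X = blk n (btr2 n X) 0 0 (btr1 n X)"
  unfolding S_op_def by (simp add: E_plus_blk E_minus_blk btr1_def btr2_def)

lemma btr_add:
  assumes "X \<in> cmat n" "Y \<in> cmat n"
  shows "btr1 n (X + Y) = btr1 n X + btr1 n Y" "btr2 n (X + Y) = btr2 n X + btr2 n Y"
  using assms unfolding btr1_def btr2_def E_plus_blk E_minus_blk
  by (simp_all add: add_mult_distrib_mat[of _ "2 * n" "2 * n" _ _ "2 * n"] ntrace_add[of _ n])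

lemma btr_minus:
  assumes "X \<in> cmat n" "Y \<in> cmat n"
  shows "btr1 n (X - Y) = btr1 n X - btr1 n Y" "btr2 n (X - Y) = btr2 n X - btr2 n Y"
  using assms unfolding btr1_def btr2_def E_plus_blk E_minus_blk
  by (simp_all add: minus_mult_distrib_mat[of _ "2 * n" "2 * n" _ _ "2 * n"] ntrace_minus[of _ n])

lemma btr_blk:
  assumes "n \<ge> 1"
  shows "btr1 n (blk n a b c d) = a" "btr2 n (blk n a b c d) = d"
  using assms unfolding btr1_def btr2_def E_plus_blk E_minus_blk
  by (simp_all add: ntrace_blk field_simps)

lemma cmod_btr_le:
  assumes X: "X \<in> cmat n"
  shows "cmod (btr1 n X) \<le> 4 * op_norm X" "cmod (btr2 n X) \<le> 4 * op_norm X"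
proof -
  have "cmod (ntrace n (X * blk n 1 0 0 e)) \<le> 2 * op_norm X" if "cmod e = 1" for e
  proof -
    have "cmod (ntrace n (X * blk n 1 0 0 e)) \<le> op_norm (X * blk n 1 0 0 e)"
      using X by (intro cmod_ntrace_le) auto
    also have "\<dots> \<le> op_norm X * op_norm (blk n 1 0 0 e)"
      using X by (intro op_norm_mult[of _ "2 * n" "2 * n" _ "2 * n"]) auto
    also have "\<dots> \<le> op_norm X * 2"
      using op_norm_blk[of n 1 0 0 e] that by (intro mult_left_mono) auto
    finally show ?thesis by simp
  qed
  from this[of 1] this[of "-1"]
  have "cmod (ntrace n (X * E_plus n)) + cmod (ntrace n (X * E_minus n)) \<le> 4 * op_norm X"
    by (simp add: E_plus_blk E_minus_blk)
  then show "cmod (btr1 n X) \<le> 4 * op_norm X" "cmod (btr2 n X) \<le> 4 * op_norm X"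
    unfolding btr1_def btr2_def
    using norm_triangle_ineq[of "ntrace n (X * E_plus n)" "ntrace n (X * E_minus n)"]
      norm_triangle_ineq4[of "ntrace n (X * E_plus n)" "ntrace n (X * E_minus n)"] by linarith+
qed

section \<open>The scalar equation\<close>

text \<open>\<open>v = Im m\<close> and \<open>u = u_sol\<close> at the spectral parameter \<open>\<i> \<eta>\<close>.\<close>

definition m_data :: "complex \<Rightarrow> real \<Rightarrow> real \<Rightarrow> real \<Rightarrow> bool" where
  "m_data z \<eta> v u \<longleftrightarrow> 0 < u \<and> u < 1 \<and> 0 < v * \<eta> \<and>
     u = v\<^sup>2 + (cmod z)\<^sup>2 * u\<^sup>2 \<and> u * \<eta> = (1 - u) * v"

lemma m_data_uminus: "m_data z \<eta> v u \<Longrightarrow> m_data z (- \<eta>) (- v) u"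
  by (simp add: m_data_def)

lemma m_data_exists:
  assumes "\<eta> \<noteq> 0"
  obtains v u where "m_data z \<eta> v u"
proof -
  have pos: "\<exists>v u. m_data z h v u" if h: "0 < h" for h
  proof -
    \<comment> \<open>With \<open>m = \<i> v\<close> and \<open>w = \<i> h\<close> the equation
      reads \<open>1 / v = (h + v) + |z|\<^sup>2 / (h + v)\<close>; \<open>f\<close> results from
      clearing denominators. It is negative at \<open>0\<close> and nonnegative at
      \<open>1\<close>.\<close>
    define f where "f v = v * (h + v)\<^sup>2 + (cmod z)\<^sup>2 * v - (h + v)" for v
    have "\<exists>v\<ge>0. v \<le> 1 \<and> f v = 0"
    proof (rule IVT')
      show "f 0 \<le> 0" using h by (simp add: f_def)
      have "(h + 1)\<^sup>2 \<ge> h + 1" using h by (simp add: power2_eq_square)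
      then show "0 \<le> f 1" by (simp add: f_def add_increasing2)
      show "continuous_on {0..1} f" unfolding f_def by (intro continuous_intros)
    qed simp
    then obtain v where v: "v \<ge> 0" "f v = 0" by auto
    have "v \<noteq> 0" using v h by (auto simp: f_def)
    with v have v0: "v > 0" by simp
    define u where "u = v / (h + v)"
    have hv: "h + v = v / u" "0 < u" using v0 h by (auto simp: u_def)
    have "v * (v / u)\<^sup>2 + (cmod z)\<^sup>2 * v = v / u" using v(2) unfolding f_def hv(1) by simp
    then have "(u * v) * u = (u * v) * (v\<^sup>2 + (cmod z)\<^sup>2 * u\<^sup>2)" using v0 hv(2)
      by (simp add: field_simps power2_eq_square)
    then have "u = v\<^sup>2 + (cmod z)\<^sup>2 * u\<^sup>2" using v0 hv(2) by simp
    moreover have "u < 1" using v0 h by (simp add: u_def)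
    moreover have "u * h = (1 - u) * v" using hv by (simp add: field_simps)
    ultimately show ?thesis using v0 h hv(2) unfolding m_data_def by (metis mult_pos_pos)
  qed
  show ?thesis
  proof (cases "0 < \<eta>")
    case True then show ?thesis using pos that by blast
  next
    case False
    then obtain v u where "m_data z (- \<eta>) v u" using pos[of "- \<eta>"] assms by auto
    then show ?thesis using m_data_uminus[of z "- \<eta>" v u] that by simp
  qed
qed

text \<open>Take imaginary parts of the equation. Subtracting the equations of two solutions and
  Cauchy--Schwarz then give uniqueness.\<close>

lemma m_eq_contraction:
  assumes eq: "- 1 / m = w + m - of_real ((cmod z)\<^sup>2) / (w + m)" and im: "Im m * Im w > 0"
  shows "(cmod m)\<^sup>2 * (1 + (cmod z / cmod (w + m))\<^sup>2) < 1"
proof -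
  have im_inv: "Im (of_real a / x) = - a * Im x / (cmod x)\<^sup>2" for a and x :: complex
    by (simp add: Im_divide cmod_power2)
  have m0: "m \<noteq> 0" using im by auto
  define r where "r = (cmod z / cmod (w + m))\<^sup>2"
  have r: "r \<ge> 0" by (simp add: r_def)
  have "Im (- 1 / m) = Im m / (cmod m)\<^sup>2" using im_inv[of "-1" m] by simp
  moreover have "Im (w + m - of_real ((cmod z)\<^sup>2) / (w + m)) = (Im w + Im m) * (1 + r)"
    by (simp only: minus_complex.sel im_inv) (simp add: r_def power_divide algebra_simps flip: add_divide_distrib)
  ultimately have "Im m / (cmod m)\<^sup>2 = (Im w + Im m) * (1 + r)" using arg_cong[OF eq, of Im] by metis
  then have "Im m = (Im w + Im m) * (1 + r) * (cmod m)\<^sup>2"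
    using m0 by (simp add: nonzero_divide_eq_eq)
  then have "(Im m)\<^sup>2 = Im m * ((Im w + Im m) * (1 + r) * (cmod m)\<^sup>2)"
    unfolding power2_eq_square[of "Im m"] by presburger
  also have "\<dots> = (Im m * Im w + (Im m)\<^sup>2) * ((cmod m)\<^sup>2 * (1 + r))"
    by (simp add: algebra_simps power2_eq_square)
  finally have "(Im m)\<^sup>2 = (Im m * Im w + (Im m)\<^sup>2) * ((cmod m)\<^sup>2 * (1 + r))" .
  \<comment> \<open>The sign condition enters here: dropping the positive \<open>Im m * Im w\<close>
    is what makes the inequality strict.\<close>
  moreover have "(Im m * Im w + (Im m)\<^sup>2) * ((cmod m)\<^sup>2 * (1 + r)) > (Im m)\<^sup>2 * ((cmod m)\<^sup>2 * (1 + r))"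
    using m0 r im by (intro mult_strict_right_mono mult_pos_pos) auto
  ultimately have "(Im m)\<^sup>2 * ((cmod m)\<^sup>2 * (1 + r)) < (Im m)\<^sup>2 * 1" by simp
  then show ?thesis unfolding r_def by (rule mult_left_less_imp_less) simp
qed

lemma m_eq_unique:
  assumes eq: "- 1 / m = w + m - of_real ((cmod z)\<^sup>2) / (w + m)" and im: "Im m * Im w > 0"
    and eq': "- 1 / m' = w + m' - of_real ((cmod z)\<^sup>2) / (w + m')" and im': "Im m' * Im w > 0"
  shows "m = m'"
proof (rule ccontr)
  assume ne: "m \<noteq> m'"
  have nz: "m \<noteq> 0" "m' \<noteq> 0" using im im' by auto
  have nw: "w + x \<noteq> 0" if "Im x * Im w > 0" for x
  proof
    assume "w + x = 0"
    then have "Im x = - Im w" by (metis add_eq_0_iff uminus_complex.sel(2))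
    with that show False by (simp add: mult_le_0_iff zero_less_mult_iff)
  qed
  note nw = nw[OF im] nw[OF im']
  define Z where "Z = complex_of_real ((cmod z)\<^sup>2)"
  define s s' where "s = cmod z / cmod (w + m)" and "s' = cmod z / cmod (w + m')"
  have ss: "s \<ge> 0" "s' \<ge> 0" by (auto simp: s_def s'_def)
  have "(m - m') / (m * m') = (- 1 / m) - (- 1 / m')" using nz by (simp add: field_simps)
  also have "\<dots> = (m - m') * (1 + Z / ((w + m) * (w + m')))"
    unfolding eq eq' using nw by (simp add: Z_def divide_simps) (simp add: algebra_simps)
  finally have "(m - m') * 1 = (m - m') * ((m * m') * (1 + Z / ((w + m) * (w + m'))))"
    using nz by (simp add: nonzero_divide_eq_eq mult_ac)
  then have "1 = (m * m') * (1 + Z / ((w + m) * (w + m')))"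
    using ne mult_left_cancel[of "m - m'"] by simp
  then have "1 = cmod (m * m') * cmod (1 + Z / ((w + m) * (w + m')))"
    by (metis norm_mult norm_one)
  also have "\<dots> \<le> cmod m * cmod m' * (1 + s * s')"
    unfolding norm_mult
    by (intro mult_left_mono norm_triangle_le)
       (auto simp: Z_def s_def s'_def norm_divide norm_mult power2_eq_square)
  finally have ge: "1 \<le> cmod m * cmod m' * (1 + s * s')" .
  have "1 \<le> (cmod m * cmod m' * (1 + s * s'))\<^sup>2" using ge by (simp add: one_le_power)
  also have "\<dots> \<le> (cmod m)\<^sup>2 * (cmod m')\<^sup>2 * ((1 + s\<^sup>2) * (1 + s'\<^sup>2))"
    unfolding power_mult_distrib
  proof (rule mult_left_mono)
    have "(1 + s\<^sup>2) * (1 + s'\<^sup>2) - (1 + s * s')\<^sup>2 = (s - s')\<^sup>2"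
      by (simp add: algebra_simps power2_eq_square)
    then show "(1 + s * s')\<^sup>2 \<le> (1 + s\<^sup>2) * (1 + s'\<^sup>2)"
      using zero_le_power2[of "s - s'"] by linarith
  qed simp
  also have "\<dots> = ((cmod m)\<^sup>2 * (1 + s\<^sup>2)) * ((cmod m')\<^sup>2 * (1 + s'\<^sup>2))" by simp
  also have "\<dots> < 1 * 1"
    unfolding s_def s'_def using m_eq_contraction[OF eq im] m_eq_contraction[OF eq' im']
    by (intro mult_strict_mono) auto
  finally show False by simp
qed

lemma m_data_sol:
  assumes d: "m_data z \<eta> v u"
  shows "m_sol z (\<i> * of_real \<eta>) = \<i> * of_real v" (is ?A)
    and "u_sol z (\<i> * of_real \<eta>) = of_real u" (is ?B)
proof -
  let ?w = "\<i> * complex_of_real \<eta>" and ?m = "\<i> * complex_of_real v"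
  have nz: "v \<noteq> 0" "u \<noteq> 0" and u: "u = v\<^sup>2 + (cmod z)\<^sup>2 * u\<^sup>2" "u * \<eta> = (1 - u) * v"
    using d by (auto simp: m_data_def)
  have s: "\<eta> + v = v / u" using u(2) nz by (simp add: field_simps)
  have wm: "?w + ?m = \<i> * of_real (v / u)" unfolding s[symmetric] by (simp add: algebra_simps)
  have "1 / v = v / u + (cmod z)\<^sup>2 * u / v"
    using u(1) nz by (simp add: field_simps power2_eq_square)
  then have r: "complex_of_real (1 / v) = of_real (v / u + (cmod z)\<^sup>2 * u / v)" by presburger
  have "- 1 / ?m = \<i> * of_real (1 / v)" using nz by (simp add: field_simps)
  also have "\<dots> = \<i> * of_real (v / u + (cmod z)\<^sup>2 * u / v)" by (simp only: r)
  also have "\<dots> = ?w + ?m - of_real ((cmod z)\<^sup>2) / (?w + ?m)"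
    unfolding wm using nz by (simp add: field_simps)
  finally have eq: "- 1 / ?m = ?w + ?m - of_real ((cmod z)\<^sup>2) / (?w + ?m)" .
  have im: "Im ?m * Im ?w > 0" using d by (simp add: m_data_def)
  show ?A
    unfolding m_sol_def
  proof (rule the_equality)
    show "- 1 / ?m = ?w + ?m - of_real ((cmod z)\<^sup>2) / (?w + ?m) \<and> 0 < Im ?m * Im ?w"
      using eq im by (rule conjI)
  qed (elim conjE, rule m_eq_unique[OF _ _ eq im])
  then show ?B unfolding u_sol_def using wm nz by simp
qed

text \<open>The constant is \<open>11\<^sup>2 + 10\<^sup>2\<close>, from \<open>|\<eta> + v| \<le> 11\<close> and \<open>|z| \<le> 10\<close>.\<close>

lemma m_data_bounds:
  assumes d: "m_data z \<eta> v u" and z: "cmod z < 10" and \<eta>: "\<bar>\<eta>\<bar> < 10"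
  shows "\<bar>v\<bar> \<le> 1" "1 \<le> 221 * u" "u * \<bar>\<eta>\<bar> = (1 - u) * \<bar>v\<bar>" "v \<noteq> 0"
proof -
  have u: "0 < u" "u < 1" "u = v\<^sup>2 + (cmod z)\<^sup>2 * u\<^sup>2" "u * \<eta> = (1 - u) * v"
    using d by (auto simp: m_data_def)
  have "v\<^sup>2 \<le> 1" using u by (smt (verit) zero_le_power2 mult_nonneg_nonneg)
  then show v1: "\<bar>v\<bar> \<le> 1" by (simp add: abs_square_le_1)
  show "v \<noteq> 0" using d by (auto simp: m_data_def)
  show "u * \<bar>\<eta>\<bar> = (1 - u) * \<bar>v\<bar>" using arg_cong[OF u(4), of abs] u(1,2) by (simp add: abs_mult)
  have "v = u * (\<eta> + v)" using u(4) by (simp add: algebra_simps)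
  then have "v\<^sup>2 = u\<^sup>2 * (\<eta> + v)\<^sup>2" by (metis power_mult_distrib)
  with u(3) have "u * 1 = u * (u * ((\<eta> + v)\<^sup>2 + (cmod z)\<^sup>2))" by (simp add: algebra_simps power2_eq_square)
  then have 1: "1 = u * ((\<eta> + v)\<^sup>2 + (cmod z)\<^sup>2)" using u(1) by simp
  have "(\<eta> + v)\<^sup>2 \<le> 11\<^sup>2" using v1 \<eta> by (intro power2_le_iff_abs_le[THEN iffD2]) auto
  moreover have "(cmod z)\<^sup>2 \<le> 10\<^sup>2" using z by (intro power_mono) auto
  ultimately have "u * ((\<eta> + v)\<^sup>2 + (cmod z)\<^sup>2) \<le> u * 221" using u(1) by (intro mult_left_mono) auto
  with 1 show "1 \<le> 221 * u" by simp
qed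

section \<open>The determinant and the control parameters\<close>

text \<open>\<open>bet\<close> is the determinant of the 2 by 2 system for the block traces in \<open>B_inv_mb\<close> below.\<close>

definition kap :: "complex \<Rightarrow> real \<Rightarrow> complex \<Rightarrow> real \<Rightarrow> complex" where
  "kap z1 u1 z2 u2 = z1 * cnj z2 * of_real (u1 * u2)"

definition bet :: "complex \<Rightarrow> real \<Rightarrow> real \<Rightarrow> complex \<Rightarrow> real \<Rightarrow> real \<Rightarrow> real" where
  "bet z1 v1 u1 z2 v2 u2 = (cmod (1 - kap z1 u1 z2 u2))\<^sup>2 - (v1 * v2)\<^sup>2"

text \<open>\<open>v\<close> and \<open>u\<close> are parameters constrained by
  \<open>m_data\<close> rather than expressions in \<open>m_sol\<close>, and \<open>\<eta>\<close>
  may have either sign. The same estimates can thus be instantiated with the indices exchanged, with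
  both indices equal, and with signs flipped.\<close>

locale m_pair =
  fixes z1 z2 :: complex and \<eta>1 \<eta>2 v1 v2 u1 u2 :: real
  assumes data1: "m_data z1 \<eta>1 v1 u1" and data2: "m_data z2 \<eta>2 v2 u2"
    and z_bound: "cmod z1 < 10" "cmod z2 < 10"
    and \<eta>_bound: "\<bar>\<eta>1\<bar> < 10" "\<bar>\<eta>2\<bar> < 10"
begin

abbreviation "\<beta> \<equiv> bet z1 v1 u1 z2 v2 u2"
abbreviation "\<kappa> \<equiv> kap z1 u1 z2 u2"
abbreviation "t \<equiv> cmod (z1 - z2)"
text \<open>Up to constants \<open>den\<close> is \<open>gamma_hat\<close> and \<open>num / den\<close> is \<open>1 / gamma_ctrl\<close>.\<close>

definition "num = t + v1\<^sup>2 + v2\<^sup>2 + (1 - u1) + (1 - u2)"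
definition "den = t\<^sup>2 + \<bar>v1\<bar> * \<bar>\<eta>1\<bar> + \<bar>v2\<bar> * \<bar>\<eta>2\<bar> + (1 - u1)\<^sup>2 + (1 - u2)\<^sup>2"

lemma u_range: "0 < u1" "u1 < 1" "0 < u2" "u2 < 1" "1 \<le> 221 * u1" "1 \<le> 221 * u2"
  using data1 data2 m_data_bounds(2) z_bound \<eta>_bound by (auto simp: m_data_def)

lemma v_range: "0 < \<bar>v1\<bar>" "\<bar>v1\<bar> \<le> 1" "0 < \<bar>v2\<bar>" "\<bar>v2\<bar> \<le> 1"
  using m_data_bounds(1,4)[OF data1 z_bound(1) \<eta>_bound(1)]
    m_data_bounds(1,4)[OF data2 z_bound(2) \<eta>_bound(2)] by auto

lemma \<eta>_nz: "0 < \<bar>\<eta>1\<bar>" "0 < \<bar>\<eta>2\<bar>"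
  using data1 data2 by (auto simp: m_data_def)

lemma v_sq: "v1\<^sup>2 = u1 * (1 - (cmod z1)\<^sup>2 * u1)" "v2\<^sup>2 = u2 * (1 - (cmod z2)\<^sup>2 * u2)"
  using data1 data2 by (auto simp: m_data_def algebra_simps power2_eq_square)

lemma u_\<eta>: "u1 * \<bar>\<eta>1\<bar> = (1 - u1) * \<bar>v1\<bar>" "u2 * \<bar>\<eta>2\<bar> = (1 - u2) * \<bar>v2\<bar>"
  using m_data_bounds(3)[OF data1 z_bound(1) \<eta>_bound(1)]
    m_data_bounds(3)[OF data2 z_bound(2) \<eta>_bound(2)] by auto

text \<open>Multiply \<open>u |\<eta>| = (1 - u) |v|\<close> by \<open>|v|\<close>, insert
  \<open>v\<^sup>2 = u (1 - |z|\<^sup>2 u)\<close> and cancel \<open>u\<close>. This is how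
  \<open>\<eta>\<close> gets into the formula for \<open>\<beta>\<close>, whose definition does not
  mention it.\<close>

lemma v\<eta>_eq:
  "\<bar>v1\<bar> * \<bar>\<eta>1\<bar> = (1 - u1) * (1 - (cmod z1)\<^sup>2 * u1)"
  "\<bar>v2\<bar> * \<bar>\<eta>2\<bar> = (1 - u2) * (1 - (cmod z2)\<^sup>2 * u2)"
proof -
  have "u1 * (\<bar>v1\<bar> * \<bar>\<eta>1\<bar>) = (1 - u1) * v1\<^sup>2"
    using u_\<eta>(1) by (metis mult.assoc mult.left_commute power2_eq_square abs_mult_self_eq)
  also have "\<dots> = u1 * ((1 - u1) * (1 - (cmod z1)\<^sup>2 * u1))" unfolding v_sq by simp
  finally show "\<bar>v1\<bar> * \<bar>\<eta>1\<bar> = (1 - u1) * (1 - (cmod z1)\<^sup>2 * u1)" using u_range(1) by simp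
  have "u2 * (\<bar>v2\<bar> * \<bar>\<eta>2\<bar>) = (1 - u2) * v2\<^sup>2"
    using u_\<eta>(2) by (metis mult.assoc mult.left_commute power2_eq_square abs_mult_self_eq)
  also have "\<dots> = u2 * ((1 - u2) * (1 - (cmod z2)\<^sup>2 * u2))" unfolding v_sq by simp
  finally show "\<bar>v2\<bar> * \<bar>\<eta>2\<bar> = (1 - u2) * (1 - (cmod z2)\<^sup>2 * u2)" using u_range(3) by simp
qed

lemma \<eta>_le: "\<bar>\<eta>1\<bar> \<le> 221 * ((1 - u1) * \<bar>v1\<bar>)" "\<bar>\<eta>2\<bar> \<le> 221 * ((1 - u2) * \<bar>v2\<bar>)"
  using mult_right_mono[OF u_range(5) abs_ge_zero, of \<eta>1] mult_right_mono[OF u_range(6) abs_ge_zero, of \<eta>2]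
  unfolding u_\<eta>[symmetric] by auto

lemma dv_le: "(1 - u1) * v1\<^sup>2 \<le> \<bar>v1\<bar> * \<bar>\<eta>1\<bar>" "(1 - u2) * v2\<^sup>2 \<le> \<bar>v2\<bar> * \<bar>\<eta>2\<bar>"
proof -
  have "(1 - u1) * v1\<^sup>2 = u1 * (\<bar>v1\<bar> * \<bar>\<eta>1\<bar>)" unfolding v\<eta>_eq v_sq by simp
  also have "\<dots> \<le> \<bar>v1\<bar> * \<bar>\<eta>1\<bar>" using u_range by (intro mult_left_le_one_le) auto
  finally show "(1 - u1) * v1\<^sup>2 \<le> \<bar>v1\<bar> * \<bar>\<eta>1\<bar>" .
  have "(1 - u2) * v2\<^sup>2 = u2 * (\<bar>v2\<bar> * \<bar>\<eta>2\<bar>)" unfolding v\<eta>_eq v_sq by simp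
  also have "\<dots> \<le> \<bar>v2\<bar> * \<bar>\<eta>2\<bar>" using u_range by (intro mult_left_le_one_le) auto
  finally show "(1 - u2) * v2\<^sup>2 \<le> \<bar>v2\<bar> * \<bar>\<eta>2\<bar>" .
qed

lemma cmod_sq_diff: "\<bar>(cmod z1)\<^sup>2 - (cmod z2)\<^sup>2\<bar> \<le> 20 * t"
proof -
  have "\<bar>(cmod z1)\<^sup>2 - (cmod z2)\<^sup>2\<bar> = (cmod z1 + cmod z2) * \<bar>cmod z1 - cmod z2\<bar>"
    by (simp add: power2_eq_square square_diff_square_factored abs_mult)
  also have "\<dots> \<le> 20 * t"
    using z_bound norm_triangle_ineq3[of z1 z2] by (intro mult_mono) auto
  finally show ?thesis .
qed

lemma t_le: "t \<le> 20"
  using norm_triangle_ineq4[of z1 z2] z_bound by linarith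

lemma cmod_kap: "cmod \<kappa> = cmod z1 * cmod z2 * (u1 * u2)"
  using u_range by (simp add: kap_def norm_mult)

lemma cmod_one_minus_kap_sq:
  "(cmod (1 - \<kappa>))\<^sup>2 = 1 - u1 * u2 * ((cmod z1)\<^sup>2 + (cmod z2)\<^sup>2 - t\<^sup>2)
     + u1\<^sup>2 * u2\<^sup>2 * (cmod z1)\<^sup>2 * (cmod z2)\<^sup>2"
  unfolding cmod_power2 kap_def by (simp add: algebra_simps power2_eq_square)

text \<open>Once the scalar equations eliminate \<open>v1\<^sup>2\<close> and
  \<open>v2\<^sup>2\<close>, the terms with \<open>|z1|\<^sup>2 |z2|\<^sup>2\<close> cancel between
  \<open>|1 - \<kappa>|\<^sup>2\<close> and \<open>(v1 v2)\<^sup>2\<close>. The rest regroups into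
  nonnegative summands, each of which is then a lower bound by itself.\<close>

lemma \<beta>_eq:
  "\<beta> = u1 * u2 * t\<^sup>2 + (1 - u1) * (1 - u2) + u2 * (\<bar>v1\<bar> * \<bar>\<eta>1\<bar>) + u1 * (\<bar>v2\<bar> * \<bar>\<eta>2\<bar>)"
  unfolding bet_def cmod_one_minus_kap_sq power_mult_distrib v_sq v\<eta>_eq
  by (simp add: algebra_simps power2_eq_square)

lemma \<beta>_ge:
  "t\<^sup>2 \<le> 221\<^sup>2 * \<beta>" "\<bar>v1\<bar> * \<bar>\<eta>1\<bar> \<le> 221 * \<beta>" "\<bar>v2\<bar> * \<bar>\<eta>2\<bar> \<le> 221 * \<beta>"
  "(1 - u1) * (1 - u2) \<le> \<beta>" "0 < \<beta>"
proof -
  have n: "0 \<le> u1 * u2 * t\<^sup>2" "0 \<le> (1 - u1) * (1 - u2)" "0 < u2 * (\<bar>v1\<bar> * \<bar>\<eta>1\<bar>)"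
    "0 < u1 * (\<bar>v2\<bar> * \<bar>\<eta>2\<bar>)"
    using u_range v_range \<eta>_nz by auto
  show "0 < \<beta>" "(1 - u1) * (1 - u2) \<le> \<beta>" unfolding \<beta>_eq using n by linarith+
  have "1 * (\<bar>v1\<bar> * \<bar>\<eta>1\<bar>) \<le> 221 * u2 * (\<bar>v1\<bar> * \<bar>\<eta>1\<bar>)"
    "1 * (\<bar>v2\<bar> * \<bar>\<eta>2\<bar>) \<le> 221 * u1 * (\<bar>v2\<bar> * \<bar>\<eta>2\<bar>)"
    using u_range by (intro mult_right_mono; simp)+
  moreover have "221 * \<beta> = 221 * (u1 * u2 * t\<^sup>2) + 221 * ((1 - u1) * (1 - u2))
      + 221 * u2 * (\<bar>v1\<bar> * \<bar>\<eta>1\<bar>) + 221 * u1 * (\<bar>v2\<bar> * \<bar>\<eta>2\<bar>)"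
    unfolding \<beta>_eq by (simp only: distrib_left mult.assoc)
  ultimately show "\<bar>v1\<bar> * \<bar>\<eta>1\<bar> \<le> 221 * \<beta>" "\<bar>v2\<bar> * \<bar>\<eta>2\<bar> \<le> 221 * \<beta>"
    using n by linarith+
  have "1 * 1 * t\<^sup>2 \<le> (221 * u1) * (221 * u2) * t\<^sup>2"
    using u_range by (intro mult_right_mono mult_mono) auto
  then show "t\<^sup>2 \<le> 221\<^sup>2 * \<beta>" unfolding \<beta>_eq using n by simp
qed

text \<open>The equation for \<open>m\<close> determines \<open>|z|\<^sup>2 = 1/u - v\<^sup>2/u\<^sup>2\<close>. So if \<open>1 - u1\<close> exceeds \<open>2 (1 - u2)\<close>,
  then it is controlled by \<open>v1\<^sup>2\<close> or by \<open>|z1 - z2|\<close>.\<close>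

lemma inverse_u_diff: "(u2 - u1) + u1 * v2\<^sup>2 / u2 - u2 * v1\<^sup>2 / u1
    = u1 * u2 * ((cmod z1)\<^sup>2 - (cmod z2)\<^sup>2)"
proof -
  have "u1 * v2\<^sup>2 / u2 = u1 * (1 - (cmod z2)\<^sup>2 * u2)" "u2 * v1\<^sup>2 / u1 = u2 * (1 - (cmod z1)\<^sup>2 * u1)"
    using u_range by (simp_all add: v_sq)
  then show ?thesis by (simp add: algebra_simps)
qed

lemma d1_sq_le: "(1 - u1)\<^sup>2 \<le> 6400 * 221\<^sup>2 * \<beta>"
proof (cases "1 - u1 \<le> 2 * (1 - u2)")
  case True
  then have "(1 - u1) * (1 - u1) \<le> (1 - u1) * (2 * (1 - u2))" using u_range by (intro mult_left_mono) auto
  also have "\<dots> = 2 * ((1 - u1) * (1 - u2))" by simp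
  also have "\<dots> \<le> 2 * \<beta>" using \<beta>_ge(4) by linarith
  also have "\<dots> \<le> 6400 * 221\<^sup>2 * \<beta>" using \<beta>_ge(5) by simp
  finally show ?thesis by (simp add: power2_eq_square)
next
  case False
  have a: "u2 * v1\<^sup>2 / u1 \<le> 221 * v1\<^sup>2"
  proof -
    have "u2 \<le> 221 * u1" using u_range by linarith
    then have "u2 * v1\<^sup>2 \<le> (221 * u1) * v1\<^sup>2" by (intro mult_right_mono) auto
    then show ?thesis using u_range by (simp add: divide_simps mult_ac)
  qed
  have b: "u1 * u2 * ((cmod z1)\<^sup>2 - (cmod z2)\<^sup>2) \<le> 20 * t"
  proof -
    have "\<bar>u1 * u2 * ((cmod z1)\<^sup>2 - (cmod z2)\<^sup>2)\<bar> \<le> 1 * (20 * t)"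
      unfolding abs_mult[of "u1 * u2"]
      using u_range mult_le_one[of u1 u2] by (intro mult_mono cmod_sq_diff) auto
    then show ?thesis by simp
  qed
  have "0 \<le> u1 * v2\<^sup>2 / u2" using u_range by simp
  moreover have "1 - u1 > 2 - 2 * u2" using False by simp
  \<comment> \<open>In this case \<open>u2 - u1 = (1 - u1) - (1 - u2)\<close> exceeds half of
    \<open>1 - u1\<close>, and the nonnegative \<open>v2\<close> term of
    \<open>inverse_u_diff\<close> is dropped. Free variables keep the arithmetic linear.\<close>
  moreover have "x \<le> 2 * q + 2 * r"
    if "0 \<le> f" "2 - 2 * u2 < x" "u2 - u1 + f - g = h" "g \<le> q" "h \<le> r" "x = 1 - u1" for x q r f g h :: real
    using that by linarith
  ultimately have "1 - u1 \<le> 2 * (221 * v1\<^sup>2) + 2 * (20 * t)" using inverse_u_diff a b by metis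
  then have c: "1 - u1 \<le> 442 * v1\<^sup>2 + 40 * t" by simp
  \<comment> \<open>The threshold is \<open>884 = 2 * 442\<close>. If
    \<open>884 * v1\<^sup>2\<close> is the smaller side, half of \<open>1 - u1\<close> absorbs the
    \<open>v1\<close> term and \<open>80 * t\<close> remains; otherwise
    \<open>(1 - u1)\<^sup>2\<close> is at most a multiple of \<open>(1 - u1) * v1\<^sup>2\<close>,
    which \<open>dv_le\<close> controls.\<close>
  show ?thesis
  proof (cases "884 * v1\<^sup>2 \<le> 1 - u1")
    case True
    with c have "1 - u1 \<le> 80 * t" by linarith
    then have "(1 - u1)\<^sup>2 \<le> (80 * t)\<^sup>2" using u_range by (intro power_mono) auto
    also have "\<dots> \<le> 6400 * 221\<^sup>2 * \<beta>" using \<beta>_ge(1) by (simp add: power_mult_distrib)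
    finally show ?thesis .
  next
    case False
    then have "(1 - u1) * (1 - u1) \<le> (1 - u1) * (884 * v1\<^sup>2)" using u_range by (intro mult_left_mono) auto
    then have "(1 - u1)\<^sup>2 \<le> 4 * 221 * (\<bar>v1\<bar> * \<bar>\<eta>1\<bar>)" using dv_le by (simp add: power2_eq_square)
    also have "\<dots> \<le> 6400 * 221\<^sup>2 * \<beta>" using \<beta>_ge(2,5) by (simp add: mult_ac)
    finally show ?thesis .
  qed
qed

lemma bet_swap: "bet z2 v2 u2 z1 v1 u1 = \<beta>"
proof -
  have "kap z2 u2 z1 u1 = cnj \<kappa>" by (simp add: kap_def mult_ac)
  then have "cmod (1 - kap z2 u2 z1 u1) = cmod (1 - \<kappa>)"
    by (metis complex_cnj_diff complex_cnj_one complex_mod_cnj)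
  then show ?thesis by (simp add: bet_def mult.commute)
qed

lemma swap: "m_pair z2 z1 \<eta>2 \<eta>1 v2 v1 u2 u1"
  using data1 data2 z_bound \<eta>_bound by unfold_locales

text \<open>The square for the second index comes from the exchanged pair, whose determinant is the
  same. The constants add up to \<open>2 * 6400 * 221\<^sup>2 + 221\<^sup>2 + 2 * 221\<close>, which
  is below \<open>10 ^ 9\<close>.\<close>

lemma den_le: "den \<le> 10 ^ 9 * \<beta>"
proof -
  have "(1 - u2)\<^sup>2 \<le> 6400 * 221\<^sup>2 * \<beta>" using m_pair.d1_sq_le[OF swap] unfolding bet_swap .
  with d1_sq_le \<beta>_ge show ?thesis unfolding den_def by simp
qed

lemma den_pos: "0 < den"
proof -
  have "0 < \<bar>v1\<bar> * \<bar>\<eta>1\<bar>" "0 < \<bar>v2\<bar> * \<bar>\<eta>2\<bar>" using v_range \<eta>_nz by simp_all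
  then show ?thesis
    using zero_le_power2[of t] zero_le_power2[of "1 - u1"] zero_le_power2[of "1 - u2"]
    unfolding den_def by linarith
qed

section \<open>Estimates relating num, den and the smaller spectral parameter\<close>

lemma num_pos: "0 < num"
  using u_range norm_ge_zero[of "z1 - z2"] zero_le_power2[of v1] zero_le_power2[of v2]
  unfolding num_def by linarith

lemma v_le_num: "\<bar>v1\<bar> * \<bar>v2\<bar> \<le> num"
proof -
  have "2 * (\<bar>v1\<bar> * \<bar>v2\<bar>) \<le> v1\<^sup>2 + v2\<^sup>2" using sum_squares_bound[of "\<bar>v1\<bar>" "\<bar>v2\<bar>"] by simp
  moreover have "v1\<^sup>2 + v2\<^sup>2 \<le> num"
    using u_range norm_ge_zero[of "z1 - z2"] unfolding num_def by linarith
  ultimately show ?thesis by (smt (verit) zero_le_mult_iff abs_ge_zero)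
qed

text \<open>Replacing \<open>cnj z2\<close> by \<open>cnj z1\<close> in \<open>\<kappa>\<close>
  costs a multiple of \<open>t\<close>. What remains is \<open>1 - |z1|\<^sup>2 u1 u2\<close>, and
  \<open>1 - |z1|\<^sup>2 u1 = v1\<^sup>2 / u1\<close> by the scalar equation, so only summands of
  \<open>num\<close> appear.\<close>

lemma one_minus_kap_le: "cmod (1 - \<kappa>) \<le> 221 * num"
proof -
  have "1 - \<kappa> = z1 * cnj (z1 - z2) * of_real (u1 * u2) + of_real (1 - (cmod z1)\<^sup>2 * (u1 * u2))"
    unfolding kap_def by (simp add: algebra_simps flip: complex_norm_square)
  then have "cmod (1 - \<kappa>) \<le> cmod (z1 * cnj (z1 - z2) * of_real (u1 * u2))
      + cmod (of_real (1 - (cmod z1)\<^sup>2 * (u1 * u2)))"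
    by (metis norm_triangle_ineq)
  moreover have "cmod (z1 * cnj (z1 - z2) * of_real (u1 * u2)) \<le> 10 * t"
  proof -
    have "cmod (z1 * cnj (z1 - z2) * of_real (u1 * u2)) = cmod z1 * t * (u1 * u2)"
      using u_range by (simp add: norm_mult flip: complex_cnj_diff)
    also have "\<dots> \<le> 10 * t * 1"
      using u_range z_bound mult_le_one[of u1 u2] by (intro mult_mono) auto
    finally show ?thesis by simp
  qed
  moreover have "cmod (of_real (1 - (cmod z1)\<^sup>2 * (u1 * u2))) \<le> 221 * v1\<^sup>2 + (1 - u2)"
  proof -
    have q: "0 \<le> 1 - (cmod z1)\<^sup>2 * u1" using v_sq(1) u_range(1) zero_le_power2[of v1]
      by (simp add: zero_le_mult_iff)
    have "1 - (cmod z1)\<^sup>2 * (u1 * u2) = (1 - (cmod z1)\<^sup>2 * u1) + ((cmod z1)\<^sup>2 * u1) * (1 - u2)"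
      by (simp add: algebra_simps)
    moreover have "1 * (1 - (cmod z1)\<^sup>2 * u1) \<le> 221 * u1 * (1 - (cmod z1)\<^sup>2 * u1)"
      using q u_range by (intro mult_right_mono) auto
    then have "1 - (cmod z1)\<^sup>2 * u1 \<le> 221 * v1\<^sup>2" by (simp add: v_sq)
    moreover have "((cmod z1)\<^sup>2 * u1) * (1 - u2) \<le> 1 - u2"
      using q u_range by (intro mult_left_le_one_le) auto
    moreover have "0 \<le> ((cmod z1)\<^sup>2 * u1) * (1 - u2)" using u_range by auto
    ultimately show ?thesis using q unfolding norm_of_real by linarith
  qed
  ultimately show ?thesis using u_range norm_ge_zero[of "z1 - z2"] zero_le_power2[of v1] zero_le_power2[of v2]
    unfolding num_def by (smt (verit))
qed

text \<open>It bounds \<open>num / den\<close> from below, so that terms which are merely bounded,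
  such as \<open>M1 A M2\<close>, can be absorbed into a multiple of
  \<open>num / den\<close>.\<close>

lemma den_le_num: "den \<le> 221 * num"
proof -
  have "t\<^sup>2 \<le> 20 * t" using t_le by (simp add: power2_eq_square mult_right_mono)
  moreover have "\<bar>v1\<bar> * \<bar>\<eta>1\<bar> \<le> \<bar>v1\<bar> * (221 * (1 * \<bar>v1\<bar>))" 
    using u_range by (intro mult_left_mono order_trans[OF \<eta>_le(1)] mult_right_mono) auto
  then have "\<bar>v1\<bar> * \<bar>\<eta>1\<bar> \<le> 221 * v1\<^sup>2" by (simp add: power2_eq_square)
  moreover have "\<bar>v2\<bar> * \<bar>\<eta>2\<bar> \<le> \<bar>v2\<bar> * (221 * (1 * \<bar>v2\<bar>))"
    using u_range by (intro mult_left_mono order_trans[OF \<eta>_le(2)] mult_right_mono) auto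
  then have "\<bar>v2\<bar> * \<bar>\<eta>2\<bar> \<le> 221 * v2\<^sup>2" by (simp add: power2_eq_square)
  moreover have "(1 - u1)\<^sup>2 \<le> 1 - u1" "(1 - u2)\<^sup>2 \<le> 1 - u2"
    using u_range by (simp_all add: power2_eq_square mult_left_le)
  ultimately show ?thesis using u_range norm_ge_zero[of "z1 - z2"] unfolding den_def num_def by (smt (verit))
qed

text \<open>Distribute \<open>d\<close> over \<open>num\<close>: \<open>d * t\<close> splits by the
  arithmetic-geometric mean inequality, \<open>dv_le\<close> covers \<open>d * v1\<^sup>2\<close>
  and \<open>d * v2\<^sup>2\<close>, and the rest is bounded by the squares in \<open>den\<close>.
  Since \<open>num\<close> involves both indices, \<open>d\<close> must lie below both
  \<open>1 - u1\<close> and \<open>1 - u2\<close>.\<close>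

lemma min_num_le_den:
  assumes "0 \<le> d" "d \<le> 1 - u1" "d \<le> 1 - u2"
  shows "d * num \<le> 2 * den"
proof -
  have "2 * (d * t) \<le> d\<^sup>2 + t\<^sup>2" using sum_squares_bound[of d t] by simp
  moreover have "d\<^sup>2 \<le> (1 - u1)\<^sup>2" using assms by (intro power_mono) auto
  moreover have "d * v1\<^sup>2 \<le> (1 - u1) * v1\<^sup>2" "d * v2\<^sup>2 \<le> (1 - u2) * v2\<^sup>2"
    using assms by (intro mult_right_mono; simp)+
  moreover have "d * (1 - u1) \<le> (1 - u1)\<^sup>2" "d * (1 - u2) \<le> (1 - u2)\<^sup>2"
    using assms u_range unfolding power2_eq_square by (intro mult_right_mono; simp)+
  moreover have "0 \<le> \<bar>v1\<bar> * \<bar>\<eta>1\<bar>" "0 \<le> \<bar>v2\<bar> * \<bar>\<eta>2\<bar>" by auto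
  moreover have "d * num = d * t + d * v1\<^sup>2 + d * v2\<^sup>2 + d * (1 - u1) + d * (1 - u2)"
    by (simp only: num_def distrib_left)
  ultimately show ?thesis using dv_le unfolding den_def by (smt (verit) zero_le_power2)
qed

abbreviation "\<eta>min \<equiv> min \<bar>\<eta>1\<bar> \<bar>\<eta>2\<bar>"

text \<open>This is the exchange rate: when two factors \<open>num / den\<close> occur, one of them
  can be replaced by a multiple of \<open>1 / \<eta>min\<close>.\<close>

lemma \<eta>min_num_le: "\<eta>min * num \<le> 442 * den"
proof -
  define d where "d = min (1 - u1) (1 - u2)"
  have "(1 - u1) * \<bar>v1\<bar> \<le> 1 - u1" "(1 - u2) * \<bar>v2\<bar> \<le> 1 - u2"
    using u_range v_range by (simp_all add: mult_left_le)
  then have "\<eta>min \<le> 221 * d" using \<eta>_le unfolding d_def min_def by (smt (verit))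
  then have "\<eta>min * num \<le> 221 * (d * num)" using num_pos by simp
  also have "d * num \<le> 2 * den" using u_range by (intro min_num_le_den) (auto simp: d_def)
  finally show ?thesis by simp
qed

text \<open>This is \<open>inverse_u_diff\<close> solved for \<open>v2\<^sup>2\<close>. The
  one-sided bound \<open>u1 - u2 \<le> 1 - u2\<close> keeps \<open>1 - u1\<close> out of the
  right-hand side.\<close>

lemma v2_sq_le: "v2\<^sup>2 \<le> 221\<^sup>2 * (v1\<^sup>2 + (1 - u2) + t)"
proof -
  have "u1 * v2\<^sup>2 / u2 = u1 * u2 * ((cmod z1)\<^sup>2 - (cmod z2)\<^sup>2) + u2 * v1\<^sup>2 / u1 + (u1 - u2)"
    using inverse_u_diff by linarith
  then have "v2\<^sup>2 / u2 = u2 * ((cmod z1)\<^sup>2 - (cmod z2)\<^sup>2) + u2 * v1\<^sup>2 / (u1 * u1) + (u1 - u2) / u1"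
    (is "_ = ?r")
  proof -
    assume "u1 * v2\<^sup>2 / u2 = u1 * u2 * ((cmod z1)\<^sup>2 - (cmod z2)\<^sup>2) + u2 * v1\<^sup>2 / u1 + (u1 - u2)"
    also have "\<dots> = u1 * ?r" using u_range by (simp add: distrib_left)
    finally have "u1 * (v2\<^sup>2 / u2) = u1 * ?r" by (simp only: times_divide_eq_right)
    then show ?thesis using u_range(1) by (simp only: mult_left_cancel)
  qed
  moreover have "v2\<^sup>2 \<le> v2\<^sup>2 / u2" using u_range by (simp add: le_divide_eq mult_left_le)
  moreover have "u2 * ((cmod z1)\<^sup>2 - (cmod z2)\<^sup>2) \<le> 1 * (20 * t)"
  proof -
    have "\<bar>u2 * ((cmod z1)\<^sup>2 - (cmod z2)\<^sup>2)\<bar> \<le> 1 * (20 * t)"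
      unfolding abs_mult using u_range by (intro mult_mono cmod_sq_diff) auto
    then show ?thesis by simp
  qed
  moreover have "u2 * v1\<^sup>2 / (u1 * u1) \<le> 221\<^sup>2 * v1\<^sup>2"
  proof -
    have "1 * 1 \<le> (221 * u1) * (221 * u1)" using u_range by (intro mult_mono) auto
    then have "u2 \<le> (221 * u1) * (221 * u1)" using u_range by linarith
    then have "u2 * v1\<^sup>2 \<le> ((221 * u1) * (221 * u1)) * v1\<^sup>2" by (intro mult_right_mono) auto
    then show ?thesis using u_range by (simp add: divide_simps mult_ac power2_eq_square)
  qed
  moreover have "(u1 - u2) / u1 \<le> 221\<^sup>2 * (1 - u2)"
  proof -
    have "1 * (1 - u2) \<le> (221 * u1) * (1 - u2)" using u_range by (intro mult_right_mono) auto
    moreover have "0 \<le> u1 * (1 - u2)" using u_range by auto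
    ultimately have "1 - u2 \<le> 221\<^sup>2 * (u1 * (1 - u2))" by simp
    with u_range have "u1 - u2 \<le> 221\<^sup>2 * (u1 * (1 - u2))" by linarith
    then show ?thesis using u_range by (simp add: divide_simps mult_ac)
  qed
  ultimately have "v2\<^sup>2 \<le> 1 * (20 * t) + 221\<^sup>2 * v1\<^sup>2 + 221\<^sup>2 * (1 - u2)" by linarith
  moreover have "1 * (20 * t) \<le> 221\<^sup>2 * t" by simp
  moreover have "221\<^sup>2 * (v1\<^sup>2 + (1 - u2) + t) = 221\<^sup>2 * v1\<^sup>2 + 221\<^sup>2 * (1 - u2) + 221\<^sup>2 * t"
    by (simp only: distrib_left)
  ultimately show ?thesis by linarith
qed

text \<open>Compare \<open>v2\<^sup>2\<close> with \<open>(1 - u1) + v1\<^sup>2\<close>: when it is much larger, \<open>num\<close> and \<open>den\<close> are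
  comparable to \<open>(1 - u2) + |z1 - z2|\<close> and its square.\<close>

lemma v_\<eta>min_num_le: "(\<bar>v1\<bar> + \<bar>v2\<bar>) * \<eta>min * num \<le> 10 ^ 14 * (((1 - u1) + v1\<^sup>2) * den)"
proof (cases "v2\<^sup>2 \<le> 2 * 221\<^sup>2 * ((1 - u1) + v1\<^sup>2)")
  case True
  let ?e = "(1 - u1) + v1\<^sup>2"
  have e: "0 \<le> ?e" using u_range by auto
  have vv: "\<bar>v1\<bar> * \<bar>v2\<bar> * 2 \<le> v1\<^sup>2 + v2\<^sup>2" using sum_squares_bound[of "\<bar>v1\<bar>" "\<bar>v2\<bar>"] by simp
  have v: "(\<bar>v1\<bar> + \<bar>v2\<bar>) * \<bar>v1\<bar> \<le> 6 * 221\<^sup>2 * ?e" "(\<bar>v1\<bar> + \<bar>v2\<bar>) * \<bar>v2\<bar> \<le> 6 * 221\<^sup>2 * ?e"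
  proof -
    have "(\<bar>v1\<bar> + \<bar>v2\<bar>) * \<bar>v1\<bar> = v1\<^sup>2 + \<bar>v1\<bar> * \<bar>v2\<bar>" "(\<bar>v1\<bar> + \<bar>v2\<bar>) * \<bar>v2\<bar> = v2\<^sup>2 + \<bar>v1\<bar> * \<bar>v2\<bar>"
      by (simp_all add: algebra_simps power2_eq_square)
    then show "(\<bar>v1\<bar> + \<bar>v2\<bar>) * \<bar>v1\<bar> \<le> 6 * 221\<^sup>2 * ?e" "(\<bar>v1\<bar> + \<bar>v2\<bar>) * \<bar>v2\<bar> \<le> 6 * 221\<^sup>2 * ?e"
      using vv True u_range zero_le_power2[of v1] zero_le_power2[of v2] by (simp_all add: distrib_left, linarith+)
  qed
  define d where "d = min (1 - u1) (1 - u2)"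
  have d0: "0 \<le> d" using u_range by (simp add: d_def)
  \<comment> \<open>Both \<open>|\<eta>1|\<close> and \<open>|\<eta>2|\<close> dominate
    \<open>\<eta>min\<close>; the index whose \<open>1 - u\<close> equals \<open>d\<close> is
    chosen, which produces the factor \<open>d\<close> for \<open>min_num_le_den\<close>.\<close>
  have "(\<bar>v1\<bar> + \<bar>v2\<bar>) * \<eta>min \<le> 221 * d * (6 * 221\<^sup>2 * ?e)"
  proof (cases "1 - u1 \<le> 1 - u2")
    case True
    then have "(\<bar>v1\<bar> + \<bar>v2\<bar>) * \<eta>min \<le> (\<bar>v1\<bar> + \<bar>v2\<bar>) * (221 * (d * \<bar>v1\<bar>))"
      using \<eta>_le(1) by (intro mult_left_mono) (auto simp: d_def)
    also have "\<dots> = 221 * d * ((\<bar>v1\<bar> + \<bar>v2\<bar>) * \<bar>v1\<bar>)" by simp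
    also have "\<dots> \<le> 221 * d * (6 * 221\<^sup>2 * ?e)" using v(1) d0 by (intro mult_left_mono) auto
    finally show ?thesis .
  next
    case False
    then have "(\<bar>v1\<bar> + \<bar>v2\<bar>) * \<eta>min \<le> (\<bar>v1\<bar> + \<bar>v2\<bar>) * (221 * (d * \<bar>v2\<bar>))"
      using \<eta>_le(2) by (intro mult_left_mono) (auto simp: d_def)
    also have "\<dots> = 221 * d * ((\<bar>v1\<bar> + \<bar>v2\<bar>) * \<bar>v2\<bar>)" by simp
    also have "\<dots> \<le> 221 * d * (6 * 221\<^sup>2 * ?e)" using v(2) d0 by (intro mult_left_mono) auto
    finally show ?thesis .
  qed
  then have "(\<bar>v1\<bar> + \<bar>v2\<bar>) * \<eta>min * num \<le> 221 * d * (6 * 221\<^sup>2 * ?e) * num"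
    using num_pos by (intro mult_right_mono) auto
  also have "\<dots> = (221 * 6 * 221\<^sup>2 * ?e) * (d * num)" by simp
  also have "\<dots> \<le> (221 * 6 * 221\<^sup>2 * ?e) * (2 * den)"
    using e u_range by (intro mult_left_mono min_num_le_den) (auto simp: d_def)
  also have "\<dots> = (221 * 6 * 221\<^sup>2 * 2) * (?e * den)" by simp
  also have "\<dots> \<le> 10 ^ 14 * (?e * den)"
    using e den_pos by (intro mult_right_mono) auto
  finally show ?thesis .
next
  case False
  define s where "s = (1 - u2) + t"
  have s: "0 \<le> s" using u_range by (simp add: s_def)
  have n: "0 \<le> 1 - u1" "0 \<le> v1\<^sup>2" "0 \<le> v2\<^sup>2" using u_range by auto
  \<comment> \<open>The failed case condition makes the \<open>v1\<close> term of
    \<open>v2_sq_le\<close> at most half of \<open>v2\<^sup>2\<close>, so the left side absorbs it.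
    This explains the factor 2 in the case distinction.\<close>
  have v2s: "v2\<^sup>2 \<le> 2 * 221\<^sup>2 * s" using False v2_sq_le n by (simp add: s_def)
  have big: "v1\<^sup>2 \<le> v2\<^sup>2" "(1 - u1) + v1\<^sup>2 \<le> v2\<^sup>2"
  proof -
    have "97682 * (1 - u1) + 97682 * v1\<^sup>2 < v2\<^sup>2" using False by simp
    moreover have "1 - u1 \<le> 97682 * (1 - u1)" using u_range by simp
    ultimately show "v1\<^sup>2 \<le> v2\<^sup>2" "(1 - u1) + v1\<^sup>2 \<le> v2\<^sup>2"
      using n by linarith+
  qed
  have "num \<le> s + 2 * v2\<^sup>2" using big by (simp add: num_def s_def)
  also have "\<dots> \<le> 5 * 221\<^sup>2 * s" using v2s s by simp
  finally have num_le: "num \<le> 5 * 221\<^sup>2 * s" .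
  have "s\<^sup>2 \<le> 2 * ((1 - u2)\<^sup>2 + t\<^sup>2)" using sum_squares_bound[of "1 - u2" t]
    by (simp add: s_def power2_sum)
  also have "\<dots> \<le> 2 * den" by (simp add: den_def)
  finally have s_sq: "s\<^sup>2 \<le> 2 * den" .
  have "\<bar>v1\<bar> \<le> \<bar>v2\<bar>" using big(1) by (simp add: abs_le_square_iff)
  then have "(\<bar>v1\<bar> + \<bar>v2\<bar>) * \<bar>v1\<bar> \<le> (2 * \<bar>v2\<bar>) * \<bar>v2\<bar>" by (intro mult_mono) auto
  then have vv: "(\<bar>v1\<bar> + \<bar>v2\<bar>) * \<bar>v1\<bar> \<le> 4 * 221\<^sup>2 * s" using v2s by (simp add: power2_eq_square)
  \<comment> \<open>Index 1 is used here: its factor \<open>1 - u1\<close> is kept for the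
    right-hand side, while the two factors \<open>s\<close> combine into
    \<open>s\<^sup>2 \<le> 2 * den\<close>.\<close>
  have "(\<bar>v1\<bar> + \<bar>v2\<bar>) * \<eta>min \<le> (\<bar>v1\<bar> + \<bar>v2\<bar>) * (221 * ((1 - u1) * \<bar>v1\<bar>))"
    using \<eta>_le(1) by (intro mult_left_mono) auto
  also have "\<dots> = 221 * (1 - u1) * ((\<bar>v1\<bar> + \<bar>v2\<bar>) * \<bar>v1\<bar>)" by simp
  also have "\<dots> \<le> 221 * (1 - u1) * (4 * 221\<^sup>2 * s)" using vv n by (intro mult_left_mono) auto
  finally have "(\<bar>v1\<bar> + \<bar>v2\<bar>) * \<eta>min * num \<le> 221 * (1 - u1) * (4 * 221\<^sup>2 * s) * (5 * 221\<^sup>2 * s)"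
    using num_le num_pos n s by (intro mult_mono[OF _ num_le]) auto
  also have "\<dots> = (221 * 4 * 221\<^sup>2 * 5 * 221\<^sup>2) * ((1 - u1) * s\<^sup>2)" by (simp add: power2_eq_square)
  also have "\<dots> \<le> (221 * 4 * 221\<^sup>2 * 5 * 221\<^sup>2) * (((1 - u1) + v1\<^sup>2) * (2 * den))"
    using s_sq n by (intro mult_left_mono mult_mono) auto
  also have "\<dots> = (221 * 4 * 221\<^sup>2 * 5 * 221\<^sup>2 * 2) * (((1 - u1) + v1\<^sup>2) * den)" by simp
  also have "\<dots> \<le> 10 ^ 14 * (((1 - u1) + v1\<^sup>2) * den)"
    using n den_pos by (intro mult_right_mono) auto
  finally show ?thesis .
qed

end

section \<open>Inverting the stability operator\<close>

lemma cmat_mult [simp, intro]: "A \<in> cmat n \<Longrightarrow> B \<in> cmat n \<Longrightarrow> A * B \<in> cmat n"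
  by (rule mult_carrier_mat)

lemma cmat_add_minus:
  assumes "X \<in> cmat n" "W \<in> cmat n"
  shows "X + W - W = X" "X - W + W = X"
  using assms by (auto intro!: eq_matI)

definition mb :: "nat \<Rightarrow> real \<Rightarrow> real \<Rightarrow> complex \<Rightarrow> complex mat" where
  "mb n v u z = blk n (\<i> * of_real v) (- z * of_real u) (- cnj z * of_real u) (\<i> * of_real v)"

lemma mb_carrier [simp]: "mb n v u z \<in> cmat n"
  by (simp add: mb_def)

lemma M_mat_mb: "m_data z \<eta> v u \<Longrightarrow> M_mat n z (\<i> * of_real \<eta>) = mb n v u z"
  by (simp add: M_mat_def mb_def blk_def m_data_sol)

lemma mb_blk_mb:
  assumes "n \<ge> 1"
  shows "btr1 n (mb n v1 u1 z1 * blk n a 0 0 b * mb n v2 u2 z2) = kap z1 u1 z2 u2 * b - of_real (v1 * v2) * a"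
    and "btr2 n (mb n v1 u1 z1 * blk n a 0 0 b * mb n v2 u2 z2) = cnj (kap z1 u1 z2 u2) * a - of_real (v1 * v2) * b"
  using assms unfolding mb_def by (simp_all add: btr_blk kap_def algebra_simps)

text \<open>Cramer's rule for \<open>(1 - \<kappa>) x1 + k x2 = t1\<close> and
  \<open>k x1 + (1 - cnj \<kappa>) x2 = t2\<close> with \<open>k = v1 v2\<close>. The block traces
  \<open>x1\<close>, \<open>x2\<close> of \<open>R\<close> solve this system when
  \<open>R - P * S_op n R * Q\<close> has block traces \<open>t1\<close>, \<open>t2\<close>.\<close>

definition xs1 :: "complex \<Rightarrow> real \<Rightarrow> real \<Rightarrow> complex \<Rightarrow> real \<Rightarrow> real \<Rightarrow> complex \<Rightarrow> complex \<Rightarrow> complex" where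
  "xs1 z1 v1 u1 z2 v2 u2 t1 t2 =
     ((1 - cnj (kap z1 u1 z2 u2)) * t1 - of_real (v1 * v2) * t2) / of_real (bet z1 v1 u1 z2 v2 u2)"
definition xs2 :: "complex \<Rightarrow> real \<Rightarrow> real \<Rightarrow> complex \<Rightarrow> real \<Rightarrow> real \<Rightarrow> complex \<Rightarrow> complex \<Rightarrow> complex" where
  "xs2 z1 v1 u1 z2 v2 u2 t1 t2 =
     ((1 - kap z1 u1 z2 u2) * t2 - of_real (v1 * v2) * t1) / of_real (bet z1 v1 u1 z2 v2 u2)"

lemma of_real_bet:
  "complex_of_real (bet z1 v1 u1 z2 v2 u2) =
     (1 - kap z1 u1 z2 u2) * (1 - cnj (kap z1 u1 z2 u2)) - (of_real (v1 * v2))\<^sup>2"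
  using complex_norm_square[of "1 - kap z1 u1 z2 u2"] unfolding bet_def by simp

text \<open>The equation \<open>R = Y + P * S_op n R * Q\<close> recovers \<open>R\<close> from its
  two block traces, so solving for these gives a preimage of \<open>Y\<close>. Because
  \<open>B_inv\<close> is an \<open>inv_into\<close>, injectivity is needed as well: the differences
  of the block traces of two preimages solve the homogeneous system.\<close>

lemma B_inv_mb:
  assumes n: "n \<ge> 1" and \<beta>: "bet z1 v1 u1 z2 v2 u2 \<noteq> 0" and Y: "Y \<in> cmat n"
  defines "x1 \<equiv> xs1 z1 v1 u1 z2 v2 u2 (btr1 n Y) (btr2 n Y)"
    and "x2 \<equiv> xs2 z1 v1 u1 z2 v2 u2 (btr1 n Y) (btr2 n Y)"
    and "P \<equiv> mb n v1 u1 z1" and "Q \<equiv> mb n v2 u2 z2"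
  shows "B_inv n P Q Y = Y + P * blk n x2 0 0 x1 * Q"
    and "S_op n (B_inv n P Q Y) = blk n x2 0 0 x1"
proof -
  define k where "k = complex_of_real (v1 * v2)"
  define c where "c = kap z1 u1 z2 u2"
  define b where "b = complex_of_real (bet z1 v1 u1 z2 v2 u2)"
  have b: "b = (1 - c) * (1 - cnj c) - k\<^sup>2" "b \<noteq> 0"
    using \<beta> by (simp_all only: b_def c_def k_def of_real_bet[symmetric] of_real_eq_0_iff not_False_eq_True)
  have PQ: "P \<in> cmat n" "Q \<in> cmat n" by (simp_all add: P_def Q_def)
  have W: "P * blk n a 0 0 d * Q \<in> cmat n" for a d using PQ by simp
  let ?X = "Y + P * blk n x2 0 0 x1 * Q"
  have X: "?X \<in> cmat n" using Y W by simp
  have x: "x1 = ((1 - cnj c) * btr1 n Y - k * btr2 n Y) / b" "x2 = ((1 - c) * btr2 n Y - k * btr1 n Y) / b"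
    by (simp_all add: x1_def x2_def xs1_def xs2_def b_def c_def k_def)
  have tr: "btr1 n (P * blk n a 0 0 d * Q) = c * d - k * a" "btr2 n (P * blk n a 0 0 d * Q) = cnj c * a - k * d" for a d
    unfolding P_def Q_def c_def k_def by (rule mb_blk_mb[OF n])+
  have "b * btr1 n ?X = b * x1" "b * btr2 n ?X = b * x2"
    unfolding btr_add[OF Y W] tr distrib_left
    using b(2) by (simp_all add: x divide_simps) (simp_all add: b(1) algebra_simps power2_eq_square)
  then have bX: "btr1 n ?X = x1" "btr2 n ?X = x2" using b(2) by auto
  then have SX: "S_op n ?X = blk n x2 0 0 x1" by (simp add: S_op_blk)
  have inj: "inj_on (B_op n P Q) (cmat n)"
  proof (rule inj_onI)
    fix R R' assume R: "R \<in> cmat n" "R' \<in> cmat n" and eq: "B_op n P Q R = B_op n P Q R'"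
    define e1 e2 where "e1 = btr1 n R - btr1 n R'" and "e2 = btr2 n R - btr2 n R'"
    have "btr1 n (B_op n P Q R) = btr1 n (B_op n P Q R')" "btr2 n (B_op n P Q R) = btr2 n (B_op n P Q R')"
      using eq by simp_all
    then have e: "(1 - c) * e1 + k * e2 = 0" "(1 - cnj c) * e2 + k * e1 = 0"
      unfolding B_op_def S_op_blk using R W
      by (simp_all add: btr_minus tr e1_def e2_def algebra_simps)
    have "b * e1 = (1 - cnj c) * ((1 - c) * e1 + k * e2) - k * ((1 - cnj c) * e2 + k * e1)"
      "b * e2 = (1 - c) * ((1 - cnj c) * e2 + k * e1) - k * ((1 - c) * e1 + k * e2)"
      unfolding b(1) by (simp_all add: algebra_simps power2_eq_square)
    then have "e1 = 0" "e2 = 0" using e b(2) by auto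
    then have S: "S_op n R = S_op n R'" by (simp add: S_op_blk e1_def e2_def)
    let ?W = "P * S_op n R' * Q"
    have W': "?W \<in> cmat n" unfolding S_op_blk by (rule W)
    have "R = B_op n P Q R + ?W" using cmat_add_minus(2)[OF R(1) W'] unfolding B_op_def S by simp
    also have "\<dots> = R'" using cmat_add_minus(2)[OF R(2) W'] unfolding eq unfolding B_op_def by simp
    finally show "R = R'" .
  qed
  have "B_op n P Q ?X = Y"
    unfolding B_op_def SX by (rule cmat_add_minus(1)[OF Y W])
  then show 1: "B_inv n P Q Y = ?X" unfolding B_inv_def by (intro inv_into_f_eq inj X)
  show "S_op n (B_inv n P Q Y) = blk n x2 0 0 x1" unfolding 1 SX ..
qed

lemma op_norm_mult_le:
  assumes "A \<in> cmat n" "B \<in> cmat n" "op_norm A \<le> a" "op_norm B \<le> b"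
  shows "op_norm (A * B) \<le> a * b"
  using op_norm_mult[OF assms(1,2)] mult_mono[OF assms(3,4)] assms(3) op_norm_nonneg[of A] op_norm_nonneg[of B]
  by linarith

section \<open>The norm bound on M12\<close>

context m_pair
begin

abbreviation "P n \<equiv> mb n v1 u1 z1"
abbreviation "Q n \<equiv> mb n v2 u2 z2"

lemma op_norm_mb: "op_norm (P n) \<le> 22" "op_norm (Q n) \<le> 22"
proof -
  have *: "op_norm (mb n v u z) \<le> 22" if "\<bar>v\<bar> \<le> 1" "0 < u" "u < 1" "cmod z < 10" for v u z
  proof -
    have "cmod z * u \<le> 10 * 1" using that by (intro mult_mono) auto
    then show ?thesis
      using op_norm_blk[of n "\<i> * of_real v" "- z * of_real u" "- cnj z * of_real u" "\<i> * of_real v"] that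
      unfolding mb_def by (simp add: norm_mult mult.commute[of u])
  qed
  show "op_norm (P n) \<le> 22" "op_norm (Q n) \<le> 22"
    using * v_range u_range z_bound by auto
qed

lemma op_norm_PAQ:
  assumes "A \<in> cmat n" shows "op_norm (P n * A * Q n) \<le> 484 * op_norm A"
  using op_norm_mult_le[of "P n * A" n "Q n" "22 * op_norm A" 22] op_norm_mult_le[of "P n" n A 22 "op_norm A"]
    assms op_norm_mb by simp

text \<open>\<open>q1\<close> and \<open>q2\<close> are the block traces of the source
  \<open>M1 A M2\<close>; \<open>x1\<close> and \<open>x2\<close> are those of \<open>M12\<close>
  itself.\<close>

definition "q1 n A = btr1 n (P n * A * Q n)"
definition "q2 n A = btr2 n (P n * A * Q n)"
definition "x1 n A = xs1 z1 v1 u1 z2 v2 u2 (q1 n A) (q2 n A)"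
definition "x2 n A = xs2 z1 v1 u1 z2 v2 u2 (q1 n A) (q2 n A)"

lemma M12_eq:
  assumes "n \<ge> 1" and A: "A \<in> cmat n"
  shows "M12 n (\<i> * of_real \<eta>1) z1 (\<i> * of_real \<eta>2) z2 A = P n * A * Q n + P n * blk n (x2 n A) 0 0 (x1 n A) * Q n"
    and "S_op n (M12 n (\<i> * of_real \<eta>1) z1 (\<i> * of_real \<eta>2) z2 A) = blk n (x2 n A) 0 0 (x1 n A)"
proof -
  have Y: "P n * A * Q n \<in> cmat n" using A by simp
  show "M12 n (\<i> * of_real \<eta>1) z1 (\<i> * of_real \<eta>2) z2 A = P n * A * Q n + P n * blk n (x2 n A) 0 0 (x1 n A) * Q n"
    "S_op n (M12 n (\<i> * of_real \<eta>1) z1 (\<i> * of_real \<eta>2) z2 A) = blk n (x2 n A) 0 0 (x1 n A)"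
    unfolding M12_def M_mat_mb[OF data1] M_mat_mb[OF data2] x1_def x2_def q1_def q2_def
    using B_inv_mb[OF assms(1) _ Y] \<beta>_ge(5) by simp_all
qed

lemma cmod_q_le:
  assumes "A \<in> cmat n" "op_norm A \<le> a"
  shows "cmod (q1 n A) \<le> 1936 * a" "cmod (q2 n A) \<le> 1936 * a"
proof -
  have "P n * A * Q n \<in> cmat n" using assms by simp
  from cmod_btr_le[OF this] op_norm_PAQ[OF assms(1)] assms(2)
  show "cmod (q1 n A) \<le> 1936 * a" "cmod (q2 n A) \<le> 1936 * a"
    unfolding q1_def q2_def by linarith+
qed

lemma cmod_x_le:
  assumes A: "A \<in> cmat n" "op_norm A \<le> a"
  shows "cmod (x1 n A) \<le> 10 ^ 15 * a * (num / den)" "cmod (x2 n A) \<le> 10 ^ 15 * a * (num / den)"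
proof -
  have a: "0 \<le> a" using A op_norm_nonneg[of A] by linarith
  have *: "cmod ((c * s - of_real (v1 * v2) * s') / of_real \<beta>) \<le> 10 ^ 15 * a * (num / den)"
    if "cmod s \<le> 1936 * a" "cmod s' \<le> 1936 * a" "cmod c \<le> 221 * num" for s s' c
  proof -
    have "cmod (c * s - of_real (v1 * v2) * s') \<le> cmod (c * s) + cmod (of_real (v1 * v2) * s')"
      by (rule norm_triangle_ineq4)
    also have "\<dots> \<le> 221 * num * (1936 * a) + num * (1936 * a)"
      unfolding norm_mult
      using that a num_pos v_le_num by (intro add_mono mult_mono) (auto simp: norm_mult)
    also have "\<dots> \<le> 10 ^ 6 * a * num" using a num_pos by simp
    finally have 1: "cmod (c * s - of_real (v1 * v2) * s') \<le> 10 ^ 6 * a * num" .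
    have "cmod ((c * s - of_real (v1 * v2) * s') / of_real \<beta>) \<le> 10 ^ 6 * a * num / \<beta>"
      using 1 \<beta>_ge(5) by (simp add: norm_divide divide_right_mono)
    also have "\<dots> \<le> 10 ^ 6 * a * num / (den / 10 ^ 9)"
      using den_le den_pos a num_pos \<beta>_ge(5) by (intro divide_left_mono) auto
    also have "\<dots> = 10 ^ 15 * a * (num / den)" by simp
    finally show ?thesis .
  qed
  note q = cmod_q_le[OF A]
  have "cmod (1 - cnj \<kappa>) \<le> 221 * num"
    using one_minus_kap_le complex_mod_cnj[of "1 - \<kappa>"] by simp
  then show "cmod (x1 n A) \<le> 10 ^ 15 * a * (num / den)"
    unfolding x1_def xs1_def using q by (intro *)
  show "cmod (x2 n A) \<le> 10 ^ 15 * a * (num / den)"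
    unfolding x2_def xs2_def using q one_minus_kap_le by (intro *)
qed

lemma op_norm_P_diag_Q:
  assumes "cmod x \<le> c" "cmod y \<le> c"
  shows "op_norm (P n * blk n x 0 0 y * Q n) \<le> 968 * c"
  using op_norm_PAQ[of "blk n x 0 0 y" n] op_norm_blk[of n x 0 0 y] assms by simp

lemma one_le_num_div_den: "1 \<le> 221 * (num / den)"
  using den_le_num den_pos by (simp add: field_simps)

lemma op_norm_M12_le:
  assumes n: "n \<ge> 1" and A: "A \<in> cmat n" "op_norm A \<le> a"
  shows "op_norm (M12 n (\<i> * of_real \<eta>1) z1 (\<i> * of_real \<eta>2) z2 A) \<le> 10 ^ 19 * a * (num / den)"
proof -
  have a: "0 \<le> a" using A op_norm_nonneg[of A] by linarith
  let ?X = "P n * blk n (x2 n A) 0 0 (x1 n A) * Q n"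
  have "P n * A * Q n \<in> cmat n" "?X \<in> cmat n" using A by simp_all
  then have "op_norm (M12 n (\<i> * of_real \<eta>1) z1 (\<i> * of_real \<eta>2) z2 A) \<le> op_norm (P n * A * Q n) + op_norm ?X"
    unfolding M12_eq(1)[OF n A(1)] by (rule op_norm_add)
  also have "\<dots> \<le> 484 * a + 968 * (10 ^ 15 * a * (num / den))"
    using op_norm_PAQ[OF A(1)] A(2) by (intro add_mono op_norm_P_diag_Q cmod_x_le A) linarith
  also have "484 * a \<le> 484 * a * (221 * (num / den))"
    using mult_left_mono[OF one_le_num_div_den, of "484 * a"] a by simp
  finally have "op_norm (M12 n (\<i> * of_real \<eta>1) z1 (\<i> * of_real \<eta>2) z2 A)
      \<le> (484 * 221 + 968 * 10 ^ 15) * (a * (num / den))" by (simp add: distrib_right)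
  also have "\<dots> \<le> 10 ^ 19 * (a * (num / den))"
    using a num_pos den_pos by (intro mult_right_mono) auto
  finally show ?thesis by (simp add: mult.assoc)
qed

end

section \<open>The component odd in both signs\<close>

lemma assoc_cmat: "A \<in> cmat n \<Longrightarrow> B \<in> cmat n \<Longrightarrow> C \<in> cmat n \<Longrightarrow> A * B * C = A * (B * C)"
  by (rule assoc_mult_mat)

lemma ntrace_linear_left:
  assumes "X \<in> cmat n" "X' \<in> cmat n" "Y \<in> cmat n"
  shows "ntrace n ((c \<cdot>\<^sub>m X + X') * Y) = c * ntrace n (X * Y) + ntrace n (X' * Y)"
proof -
  have "(c \<cdot>\<^sub>m X + X') * Y = c \<cdot>\<^sub>m (X * Y) + X' * Y"
    using assms by (subst add_mult_distrib_mat[of _ "2 * n" "2 * n" _ _ "2 * n"]) auto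
  then show ?thesis using assms by (simp add: ntrace_add ntrace_smult)
qed

lemma ntrace_linear_middle:
  assumes "W \<in> cmat n" "X \<in> cmat n" "X' \<in> cmat n" "Y \<in> cmat n"
  shows "ntrace n (W * (c \<cdot>\<^sub>m X + X') * Y) = c * ntrace n (W * X * Y) + ntrace n (W * X' * Y)"
proof -
  have "W * (c \<cdot>\<^sub>m X + X') = c \<cdot>\<^sub>m (W * X) + W * X'"
    using assms by (subst mult_add_distrib_mat[of _ "2 * n" "2 * n" _ "2 * n"]) auto
  then show ?thesis using assms by (simp add: ntrace_linear_left)
qed

lemma ntrace_smult_middle:
  assumes "W \<in> cmat n" "X \<in> cmat n" "Y \<in> cmat n"
  shows "ntrace n (W * (c \<cdot>\<^sub>m X) * Y) = c * ntrace n (W * X * Y)"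
proof -
  have "W * (c \<cdot>\<^sub>m X) = c \<cdot>\<^sub>m (W * X)" using assms(1,2) by (rule mult_smult_distrib)
  moreover have "c \<cdot>\<^sub>m (W * X) * Y = c \<cdot>\<^sub>m (W * X * Y)"
    using assms by (intro mult_smult_assoc_mat) auto
  ultimately show ?thesis using assms by (simp add: ntrace_smult)
qed

context m_pair
begin

text \<open>Functions of two signs whose part odd in \<open>s1\<close> carries a factor \<open>v1\<close>, and whose part
  odd in \<open>s2\<close> carries a factor \<open>v2\<close>. Flipping the sign of \<open>\<eta>\<close> flips \<open>v\<close> and preserves \<open>u\<close>, and
  \<open>M12_hat\<close> is the component odd in both signs.\<close>

definition sign_affine :: "real \<Rightarrow> (real \<Rightarrow> real \<Rightarrow> complex) \<Rightarrow> bool" where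
  "sign_affine C f \<longleftrightarrow> (\<exists>f0 f1 f2 f3. cmod f0 \<le> C \<and> cmod f1 \<le> C \<and> cmod f2 \<le> C \<and> cmod f3 \<le> C \<and>
     (\<forall>s1 \<in> {1, -1}. \<forall>s2 \<in> {1, -1}. f s1 s2 =
        f0 + of_real (s1 * v1) * f1 + of_real (s2 * v2) * f2 + of_real (s1 * v1 * (s2 * v2)) * f3))"

lemma sign_affine_const: "cmod c \<le> C \<Longrightarrow> sign_affine C (\<lambda>s1 s2. c)"
  unfolding sign_affine_def
  by (intro exI[of _ c] exI[of _ 0]) (auto intro: order_trans[OF norm_ge_zero])

lemma sign_affine_mono: "sign_affine C f \<Longrightarrow> C \<le> D \<Longrightarrow> sign_affine D f"
  unfolding sign_affine_def by (meson order_trans)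

lemma sign_affine_vv: "sign_affine 1 (\<lambda>s1 s2. of_real (s1 * v1 * (s2 * v2)))"
  unfolding sign_affine_def by (intro exI[of _ 1] exI[of _ 0]) auto

lemma sign_affine_add:
  assumes "sign_affine C f" "sign_affine D g"
  shows "sign_affine (C + D) (\<lambda>s1 s2. f s1 s2 + g s1 s2)"
proof -
  obtain f0 f1 f2 f3 where f: "cmod f0 \<le> C" "cmod f1 \<le> C" "cmod f2 \<le> C" "cmod f3 \<le> C"
    "\<And>s1 s2. s1 \<in> {1, -1} \<Longrightarrow> s2 \<in> {1, -1} \<Longrightarrow> f s1 s2 =
        f0 + of_real (s1 * v1) * f1 + of_real (s2 * v2) * f2 + of_real (s1 * v1 * (s2 * v2)) * f3"
    using assms(1) unfolding sign_affine_def by blast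
  obtain g0 g1 g2 g3 where g: "cmod g0 \<le> D" "cmod g1 \<le> D" "cmod g2 \<le> D" "cmod g3 \<le> D"
    "\<And>s1 s2. s1 \<in> {1, -1} \<Longrightarrow> s2 \<in> {1, -1} \<Longrightarrow> g s1 s2 =
        g0 + of_real (s1 * v1) * g1 + of_real (s2 * v2) * g2 + of_real (s1 * v1 * (s2 * v2)) * g3"
    using assms(2) unfolding sign_affine_def by blast
  show ?thesis
    unfolding sign_affine_def
    by (rule exI[of _ "f0 + g0"], rule exI[of _ "f1 + g1"], rule exI[of _ "f2 + g2"], rule exI[of _ "f3 + g3"])
       (intro conjI ballI norm_triangle_mono f g, simp only: f g, simp only: algebra_simps)
qed

text \<open>Since the signs square to 1, each coefficient of the product is a sum of four products
  of coefficients, weighted by \<open>1\<close>, \<open>v1\<^sup>2\<close>,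
  \<open>v2\<^sup>2\<close> or \<open>v1\<^sup>2 * v2\<^sup>2\<close>. These weights are at most 1,
  whence the factor 4.\<close>

lemma sign_affine_mult:
  assumes "sign_affine C f" "sign_affine D g"
  shows "sign_affine (4 * C * D) (\<lambda>s1 s2. f s1 s2 * g s1 s2)"
proof -
  obtain f0 f1 f2 f3 where f: "cmod f0 \<le> C" "cmod f1 \<le> C" "cmod f2 \<le> C" "cmod f3 \<le> C"
    "\<And>s1 s2. s1 \<in> {1, -1} \<Longrightarrow> s2 \<in> {1, -1} \<Longrightarrow> f s1 s2 =
        f0 + of_real (s1 * v1) * f1 + of_real (s2 * v2) * f2 + of_real (s1 * v1 * (s2 * v2)) * f3"
    using assms(1) unfolding sign_affine_def by blast
  obtain g0 g1 g2 g3 where g: "cmod g0 \<le> D" "cmod g1 \<le> D" "cmod g2 \<le> D" "cmod g3 \<le> D"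
    "\<And>s1 s2. s1 \<in> {1, -1} \<Longrightarrow> s2 \<in> {1, -1} \<Longrightarrow> g s1 s2 =
        g0 + of_real (s1 * v1) * g1 + of_real (s2 * v2) * g2 + of_real (s1 * v1 * (s2 * v2)) * g3"
    using assms(2) unfolding sign_affine_def by blast
  have CD: "0 \<le> C" "0 \<le> D" using f(1) g(1) norm_ge_zero order_trans by blast+
  have vv: "v1\<^sup>2 \<le> 1" "v2\<^sup>2 \<le> 1" using v_range by (simp_all add: abs_square_le_1)
  have bound: "cmod (a0 * b0 + of_real p1 * (a1 * b1) + of_real p2 * (a2 * b2) + of_real p3 * (a3 * b3)) \<le> 4 * C * D"
    if "cmod a0 \<le> C" "cmod a1 \<le> C" "cmod a2 \<le> C" "cmod a3 \<le> C"
      "cmod b0 \<le> D" "cmod b1 \<le> D" "cmod b2 \<le> D" "cmod b3 \<le> D"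
      "0 \<le> p1" "p1 \<le> 1" "0 \<le> p2" "p2 \<le> 1" "0 \<le> p3" "p3 \<le> 1" for a0 a1 a2 a3 b0 b1 b2 b3 p1 p2 p3
  proof -
    have *: "cmod (of_real p * (a * b)) \<le> C * D" if "cmod a \<le> C" "cmod b \<le> D" "0 \<le> p" "p \<le> 1" for p a b
    proof -
      have "p * (cmod a * cmod b) \<le> 1 * (C * D)" using that CD by (intro mult_mono) auto
      then show ?thesis using that by (simp add: norm_mult)
    qed
    have "cmod (a0 * b0) \<le> C * D" using *[of a0 b0 1] that by simp
    then have "cmod (a0 * b0 + of_real p1 * (a1 * b1) + of_real p2 * (a2 * b2) + of_real p3 * (a3 * b3))
        \<le> C * D + C * D + C * D + C * D"
      using that by (intro norm_triangle_mono *) auto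
    then show ?thesis by simp
  qed
  have sq: "s * s = 1" if "s \<in> {1, -1}" for s :: real using that by auto
  define h0 where "h0 = f0 * g0 + of_real (v1\<^sup>2) * (f1 * g1) + of_real (v2\<^sup>2) * (f2 * g2) + of_real (v1\<^sup>2 * v2\<^sup>2) * (f3 * g3)"
  define h1 where "h1 = f0 * g1 + of_real 1 * (f1 * g0) + of_real (v2\<^sup>2) * (f2 * g3) + of_real (v2\<^sup>2) * (f3 * g2)"
  define h2 where "h2 = f0 * g2 + of_real 1 * (f2 * g0) + of_real (v1\<^sup>2) * (f1 * g3) + of_real (v1\<^sup>2) * (f3 * g1)"
  define h3 where "h3 = f0 * g3 + of_real 1 * (f3 * g0) + of_real 1 * (f1 * g2) + of_real 1 * (f2 * g1)"
  have h: "cmod h0 \<le> 4 * C * D" "cmod h1 \<le> 4 * C * D" "cmod h2 \<le> 4 * C * D" "cmod h3 \<le> 4 * C * D"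
    unfolding h0_def h1_def h2_def h3_def using f g vv mult_le_one[of "v1\<^sup>2" "v2\<^sup>2"] by (intro bound; simp)+
  have "f s1 s2 * g s1 s2 =
      h0 + of_real (s1 * v1) * h1 + of_real (s2 * v2) * h2 + of_real (s1 * v1 * (s2 * v2)) * h3"
    if s: "s1 \<in> {1, -1}" "s2 \<in> {1, -1}" for s1 s2
  proof -
    have p: "complex_of_real (v1\<^sup>2) = of_real (s1 * v1) * of_real (s1 * v1)"
      "complex_of_real (v2\<^sup>2) = of_real (s2 * v2) * of_real (s2 * v2)"
      using sq[OF s(1)] sq[OF s(2)] s by (auto simp: power2_eq_square)
    show ?thesis
      unfolding f(5)[OF s] g(5)[OF s] h0_def h1_def h2_def h3_def of_real_mult[of "v1\<^sup>2"] p
        of_real_mult[of "s1 * v1" "s2 * v2"] of_real_1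
      by (simp only: algebra_simps mult_1_left)
  qed
  with h show ?thesis unfolding sign_affine_def by blast
qed

lemma sign_affine_cong:
  assumes "sign_affine C f" "\<And>s1 s2. s1 \<in> {1, -1} \<Longrightarrow> s2 \<in> {1, -1} \<Longrightarrow> g s1 s2 = f s1 s2"
  shows "sign_affine C g"
  using assms unfolding sign_affine_def by simp

lemma sign_affine_odd_odd:
  assumes "sign_affine C f"
  shows "cmod (f 1 (-1) + f (-1) 1 - f 1 1 - f (-1) (-1)) \<le> 4 * (\<bar>v1\<bar> * \<bar>v2\<bar> * C)"
proof -
  obtain f0 f1 f2 f3 where f: "cmod f3 \<le> C"
    "\<And>s1 s2. s1 \<in> {1, -1} \<Longrightarrow> s2 \<in> {1, -1} \<Longrightarrow> f s1 s2 =
        f0 + of_real (s1 * v1) * f1 + of_real (s2 * v2) * f2 + of_real (s1 * v1 * (s2 * v2)) * f3"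
    using assms(1) unfolding sign_affine_def by blast
  have "f 1 (-1) + f (-1) 1 - f 1 1 - f (-1) (-1) = of_real (- 4 * (v1 * v2)) * f3"
    by (simp add: f(2) algebra_simps)
  then show ?thesis
    using f(1) by (simp add: norm_mult abs_mult mult_left_mono)
qed

text \<open>\<open>mb n v u z\<close> is \<open>v J + N\<close> with \<open>J\<close> equal to
  \<open>\<i>\<close> times the identity and \<open>N\<close> its off-diagonal part. Neither depends
  on the sign, and the trace is linear in each of the two \<open>mb\<close> factors;
  \<open>484 = 22\<^sup>2\<close>.\<close>

lemma sign_affine_trace:
  assumes A: "A \<in> cmat n" "op_norm A \<le> a" and B: "B \<in> cmat n" "op_norm B \<le> b"
  shows "sign_affine (484 * a * b) (\<lambda>s1 s2. ntrace n (mb n (s1 * v1) u1 z1 * A * mb n (s2 * v2) u2 z2 * B))"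
proof -
  define J where "J = blk n \<i> 0 0 \<i>"
  define N where "N u z = blk n 0 (- z * of_real u) (- cnj z * of_real u) 0" for u z
  have c: "J \<in> cmat n" "N u z \<in> cmat n" for u z by (simp_all add: J_def N_def)
  have mb: "mb n v u z = of_real v \<cdot>\<^sub>m J + N u z" for v u z
    by (simp add: mb_def J_def N_def mult.commute)
  have J: "op_norm J \<le> 22" using op_norm_blk[of n \<i> 0 0 \<i>] by (simp add: J_def)
  have N: "op_norm (N u z) \<le> 22" if "0 < u" "u < 1" "cmod z < 10" for u z
  proof -
    have "cmod z * u \<le> 10 * 1" using that by (intro mult_mono) auto
    then show ?thesis
      using op_norm_blk[of n 0 "- z * of_real u" "- cnj z * of_real u" 0] that
      unfolding N_def by (simp add: norm_mult mult.commute[of u])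
  qed
  have T: "cmod (ntrace n (X * A * Y * B)) \<le> 484 * a * b"
    if X: "X \<in> cmat n" "op_norm X \<le> 22" and Y: "Y \<in> cmat n" "op_norm Y \<le> 22" for X Y
  proof -
    have "op_norm (X * A * Y * B) \<le> 22 * a * 22 * b"
      using X Y A B by (intro op_norm_mult_le) auto
    then show ?thesis using cmod_ntrace_le[of "X * A * Y * B" n] X Y A B by simp
  qed
  have exp: "ntrace n (mb n (s1 * v1) u1 z1 * A * mb n (s2 * v2) u2 z2 * B) =
      ntrace n (N u1 z1 * A * N u2 z2 * B) + of_real (s1 * v1) * ntrace n (J * A * N u2 z2 * B)
      + of_real (s2 * v2) * ntrace n (N u1 z1 * A * J * B)
      + of_real (s1 * v1 * (s2 * v2)) * ntrace n (J * A * J * B)" for s1 s2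
  proof -
    have l: "ntrace n ((k \<cdot>\<^sub>m X + X') * A * Y * B) = k * ntrace n (X * A * Y * B) + ntrace n (X' * A * Y * B)"
      if "X \<in> cmat n" "X' \<in> cmat n" "Y \<in> cmat n" for k X X' Y
    proof -
      have assoc: "Z * A * Y * B = Z * (A * Y * B)" if "Z \<in> cmat n" for Z
        using that \<open>Y \<in> cmat n\<close> A B assoc_cmat[of Z n A Y] assoc_cmat[of Z n "A * Y" B] by simp
      show ?thesis
        using that A B ntrace_linear_left[of X n X' "A * Y * B" k]
          assoc[of "k \<cdot>\<^sub>m X + X'"] assoc[of X] assoc[of X'] by simp
    qed
    show ?thesis
      unfolding mb using A B c by (simp add: l ntrace_linear_middle distrib_left)
  qed
  show ?thesis
    unfolding sign_affine_def exp
    by (rule exI[of _ "ntrace n (N u1 z1 * A * N u2 z2 * B)"], rule exI[of _ "ntrace n (J * A * N u2 z2 * B)"],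
        rule exI[of _ "ntrace n (N u1 z1 * A * J * B)"], rule exI[of _ "ntrace n (J * A * J * B)"])
       (use T J N c u_range z_bound in auto)
qed

lemma m_pair_sign:
  assumes "s1 \<in> {1, -1}" "s2 \<in> {1, -1}"
  shows "m_pair z1 z2 (s1 * \<eta>1) (s2 * \<eta>2) (s1 * v1) (s2 * v2) u1 u2"
  using assms data1 data2 z_bound \<eta>_bound m_data_uminus
  by unfold_locales auto

lemma bet_sign:
  "s1 \<in> {1, -1} \<Longrightarrow> s2 \<in> {1, -1} \<Longrightarrow> bet z1 (s1 * v1) u1 z2 (s2 * v2) u2 = \<beta>"
  by (auto simp: bet_def)

lemma cmod_one_minus_kap: "cmod (1 - \<kappa>) \<le> 101"
proof -
  have "cmod z1 * cmod z2 * (u1 * u2) \<le> 10 * 10 * 1"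
    using z_bound u_range mult_le_one[of u1 u2] by (intro mult_mono) auto
  then show ?thesis using norm_triangle_ineq4[of 1 \<kappa>] by (simp add: cmod_kap)
qed

text \<open>The determinant depends on \<open>v1\<close> and \<open>v2\<close> only through
  \<open>(v1 v2)\<^sup>2\<close>, so the four sign choices share it. After multiplication by
  \<open>\<beta>\<close> only sums and products of sign-affine functions remain; the division by
  \<open>\<beta>\<close> follows once the odd component has been taken.\<close>

lemma M12_hat_bound:
  assumes n: "n \<ge> 1" and A: "A \<in> cmat n" "op_norm A \<le> a" and B: "B \<in> cmat n" "op_norm B \<le> a"
    and a: "1 \<le> a"
  shows "cmod (ntrace n (M12_hat n \<eta>1 z1 \<eta>2 z2 A * B)) \<le> 10 ^ 19 * a\<^sup>2 * (\<bar>v1\<bar> * \<bar>v2\<bar> / den)"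
proof -
  define T where "T A B s1 s2 = ntrace n (mb n (s1 * v1) u1 z1 * A * mb n (s2 * v2) u2 z2 * B)" for A B and s1 s2 :: real
  define M where "M s1 s2 = M12 n (\<i> * of_real (s1 * \<eta>1)) z1 (\<i> * of_real (s2 * \<eta>2)) z2 A" for s1 s2
  define q q' where "q s1 s2 = T A (E_plus n) s1 s2 + T A (E_minus n) s1 s2"
    and "q' s1 s2 = T A (E_plus n) s1 s2 + (-1) * T A (E_minus n) s1 s2" for s1 s2
  \<comment> \<open>The Cramer numerators \<open>\<beta> x1\<close> and \<open>\<beta> x2\<close>.
    Differences are written with a factor \<open>-1\<close> because the closure rules are for sums
    and products.\<close>
  define y y' where "y s1 s2 = (1 - cnj \<kappa>) * q s1 s2 + of_real (s1 * v1 * (s2 * v2)) * (-1 * q' s1 s2)"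
    and "y' s1 s2 = (1 - \<kappa>) * q' s1 s2 + of_real (s1 * v1 * (s2 * v2)) * (-1 * q s1 s2)" for s1 s2
  define E1 E2 where "E1 = blk n 1 0 0 0" and "E2 = blk n 0 0 0 1"
  have E: "E1 \<in> cmat n" "op_norm E1 \<le> 1" "E2 \<in> cmat n" "op_norm E2 \<le> 1"
    using op_norm_blk[of n 1 0 0 0] op_norm_blk[of n 0 0 0 1] by (auto simp: E1_def E2_def)
  have Epm: "E_plus n \<in> cmat n" "op_norm (E_plus n) \<le> 2" "E_minus n \<in> cmat n" "op_norm (E_minus n) \<le> 2"
    using op_norm_blk[of n 1 0 0 1] op_norm_blk[of n 1 0 0 "-1"] by (auto simp: E_plus_blk E_minus_blk)
  have f: "of_real \<beta> * ntrace n (M s1 s2 * B)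
      = of_real \<beta> * T A B s1 s2 + (y' s1 s2 * T E1 B s1 s2 + y s1 s2 * T E2 B s1 s2)"
    if s: "s1 \<in> {1, -1}" "s2 \<in> {1, -1}" for s1 s2
  proof -
    interpret s: m_pair z1 z2 "s1 * \<eta>1" "s2 * \<eta>2" "s1 * v1" "s2 * v2" u1 u2 by (rule m_pair_sign[OF s])
    have b: "bet z1 (s1 * v1) u1 z2 (s2 * v2) u2 = \<beta>" by (rule bet_sign[OF s])
    have b0: "complex_of_real \<beta> \<noteq> 0" using \<beta>_ge(5) by simp
    have q: "q s1 s2 = s.q1 n A" "q' s1 s2 = s.q2 n A"
      by (simp_all add: q_def q'_def T_def s.q1_def s.q2_def btr1_def btr2_def)
    have y: "of_real \<beta> * s.x1 n A = y s1 s2" "of_real \<beta> * s.x2 n A = y' s1 s2"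
      using b0 by (simp_all add: s.x1_def s.x2_def xs1_def xs2_def b y_def y'_def q)
    let ?P = "s.P n" and ?Q = "s.Q n"
    have "ntrace n (?P * blk n (s.x2 n A) 0 0 (s.x1 n A) * ?Q * B)
        = s.x2 n A * T E1 B s1 s2 + s.x1 n A * T E2 B s1 s2"
    proof -
      have assoc: "?P * Z * ?Q * B = ?P * Z * (?Q * B)" if "Z \<in> cmat n" for Z
        using that B assoc_cmat[of "?P * Z" n ?Q B] by simp
      have "?P * (s.x2 n A \<cdot>\<^sub>m E1 + s.x1 n A \<cdot>\<^sub>m E2) * ?Q * B =
        ?P * (s.x2 n A \<cdot>\<^sub>m E1 + s.x1 n A \<cdot>\<^sub>m E2) * (?Q * B)" using E by (intro assoc) auto
      moreover have "ntrace n (?P * (s.x1 n A \<cdot>\<^sub>m E2) * (?Q * B)) = s.x1 n A * ntrace n (?P * E2 * (?Q * B))"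
        using E B by (intro ntrace_smult_middle) auto
      moreover have "blk n (s.x2 n A) 0 0 (s.x1 n A) = s.x2 n A \<cdot>\<^sub>m E1 + s.x1 n A \<cdot>\<^sub>m E2"
        by (simp add: E1_def E2_def)
      ultimately show ?thesis using E B by (simp add: ntrace_linear_middle T_def assoc)
    qed
    moreover have "ntrace n (M s1 s2 * B) = T A B s1 s2 + ntrace n (?P * blk n (s.x2 n A) 0 0 (s.x1 n A) * ?Q * B)"
      unfolding M_def s.M12_eq(1)[OF n A(1)] T_def using A B
      by (simp add: add_mult_distrib_mat[of _ "2 * n" "2 * n" _ _ "2 * n"] ntrace_add)
    ultimately show ?thesis by (simp add: distrib_left y[symmetric] mult.assoc)
  qed
  have TE: "sign_affine (484 * a * 2) (T A (E_plus n))" "sign_affine (484 * a * 2) (T A (E_minus n))"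
    and T1: "sign_affine (484 * 1 * a) (T E1 B)" "sign_affine (484 * 1 * a) (T E2 B)"
    and TAB: "sign_affine (484 * a * a) (T A B)"
    unfolding T_def using sign_affine_trace A B Epm E by blast+
  have TE': "sign_affine (4 * 1 * (484 * a * 2)) (\<lambda>s1 s2. -1 * T A (E_minus n) s1 s2)"
    by (intro sign_affine_mult sign_affine_const TE) simp
  define c where "c = 484 * a * 2 + 4 * 1 * (484 * a * 2)"
  have q: "sign_affine c q"
    unfolding c_def q_def using sign_affine_add[OF TE] by (rule sign_affine_mono) (use a in simp)
  have q': "sign_affine c q'"
    unfolding c_def q'_def by (rule sign_affine_add[OF TE(1) TE'])
  define e where "e = 4 * 101 * c + 4 * 1 * (4 * 1 * c)"
  have y: "sign_affine e y"
    unfolding e_def y_def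
    by (intro sign_affine_add sign_affine_mult sign_affine_vv sign_affine_const q q')
       (use cmod_one_minus_kap complex_mod_cnj[of "1 - \<kappa>"] in auto)
  have y': "sign_affine e y'"
    unfolding e_def y'_def
    by (intro sign_affine_add sign_affine_mult sign_affine_vv sign_affine_const q q')
       (use cmod_one_minus_kap in auto)
  define C where "C = 4 * 101\<^sup>2 * (484 * a * a) + (4 * e * (484 * 1 * a) + 4 * e * (484 * 1 * a))"
  have "cmod (of_real \<beta>) \<le> 101\<^sup>2"
  proof -
    have "(cmod (1 - \<kappa>))\<^sup>2 \<le> 101\<^sup>2" using cmod_one_minus_kap by (intro power_mono) auto
    moreover have "\<beta> \<le> (cmod (1 - \<kappa>))\<^sup>2" by (simp add: bet_def)
    ultimately show ?thesis using \<beta>_ge(5) by simp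
  qed
  then have "sign_affine C (\<lambda>s1 s2. of_real \<beta> * T A B s1 s2 + (y' s1 s2 * T E1 B s1 s2 + y s1 s2 * T E2 B s1 s2))"
    unfolding C_def by (intro sign_affine_add sign_affine_mult sign_affine_const TAB T1 y y')
  then have "sign_affine C (\<lambda>s1 s2. of_real \<beta> * ntrace n (M s1 s2 * B))"
    by (rule sign_affine_cong) (rule f)
  from sign_affine_odd_odd[OF this]
  have odd: "\<beta> * cmod (ntrace n (M 1 (-1) * B) + ntrace n (M (-1) 1 * B) - ntrace n (M 1 1 * B) - ntrace n (M (-1) (-1) * B))
      \<le> 4 * (\<bar>v1\<bar> * \<bar>v2\<bar> * C)"
    using \<beta>_ge(5) by (simp flip: distrib_left right_diff_distrib add: norm_mult)
  have M: "M s1 s2 \<in> cmat n" if s: "s1 \<in> {1, -1}" "s2 \<in> {1, -1}" for s1 s2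
    unfolding M_def using m_pair.M12_eq(1)[OF m_pair_sign[OF s] n A(1)] A by simp
  have "M12_hat n \<eta>1 z1 \<eta>2 z2 A = (1 / 4) \<cdot>\<^sub>m (M 1 (-1) + M (-1) 1 - M 1 1 - M (-1) (-1))"
    by (simp add: M12_hat_def M_def)
  also have "ntrace n (\<dots> * B) = (1 / 4) * (ntrace n (M 1 (-1) * B) + ntrace n (M (-1) 1 * B) - ntrace n (M 1 1 * B) - ntrace n (M (-1) (-1) * B))"
  proof -
    have "ntrace n (c \<cdot>\<^sub>m (W + X - Y - Z) * B) = c * (ntrace n (W * B) + ntrace n (X * B) - ntrace n (Y * B) - ntrace n (Z * B))"
      if "W \<in> cmat n" "X \<in> cmat n" "Y \<in> cmat n" "Z \<in> cmat n" for c W X Y Z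
    proof -
      have "W + X - Y \<in> cmat n" "W + X - Y - Z \<in> cmat n" using that by (auto intro!: minus_carrier_mat)
      then have "c \<cdot>\<^sub>m (W + X - Y - Z) * B = c \<cdot>\<^sub>m (W * B + X * B - Y * B - Z * B)"
        using that B by (simp add: mult_smult_assoc_mat[of _ "2 * n" "2 * n" _ "2 * n"]
            add_mult_distrib_mat[of _ "2 * n" "2 * n" _ _ "2 * n"]
            minus_mult_distrib_mat[of _ "2 * n" "2 * n" _ _ "2 * n"])
      moreover have "W * B + X * B - Y * B \<in> cmat n" "W * B + X * B - Y * B - Z * B \<in> cmat n"
        using that B by (auto intro!: minus_carrier_mat)
      ultimately show ?thesis using that B by (simp add: ntrace_add ntrace_minus ntrace_smult)
    qed
    then show ?thesis using M by simp
  qed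
  finally have "cmod (ntrace n (M12_hat n \<eta>1 z1 \<eta>2 z2 A * B))
      = 1 / 4 * cmod (ntrace n (M 1 (-1) * B) + ntrace n (M (-1) 1 * B) - ntrace n (M 1 1 * B) - ntrace n (M (-1) (-1) * B))"
    by (simp only: norm_mult) simp
  moreover have "\<beta> * (1 / 4 * x) \<le> y" if "\<beta> * x \<le> 4 * y" for x y using that by simp
  ultimately have "\<beta> * cmod (ntrace n (M12_hat n \<eta>1 z1 \<eta>2 z2 A * B)) \<le> \<bar>v1\<bar> * \<bar>v2\<bar> * C"
    using odd by presburger
  moreover have "C \<le> 10 ^ 10 * a\<^sup>2"
    unfolding C_def e_def c_def using a by (simp add: power2_eq_square)
  ultimately have 1: "\<beta> * cmod (ntrace n (M12_hat n \<eta>1 z1 \<eta>2 z2 A * B)) \<le> \<bar>v1\<bar> * \<bar>v2\<bar> * (10 ^ 10 * a\<^sup>2)"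
    by (smt (verit) mult_left_mono mult_nonneg_nonneg abs_ge_zero)
  have "den * cmod (ntrace n (M12_hat n \<eta>1 z1 \<eta>2 z2 A * B))
      \<le> 10 ^ 9 * (\<beta> * cmod (ntrace n (M12_hat n \<eta>1 z1 \<eta>2 z2 A * B)))"
    using mult_right_mono[OF den_le norm_ge_zero] by (simp add: mult.assoc)
  also have "\<dots> \<le> 10 ^ 9 * (\<bar>v1\<bar> * \<bar>v2\<bar> * (10 ^ 10 * a\<^sup>2))" using 1 by simp
  finally show ?thesis using den_pos by (simp add: field_simps)
qed

end

section \<open>The three-resolvent term\<close>

context m_pair
begin

interpretation swap: m_pair z2 z1 \<eta>2 \<eta>1 v2 v1 u2 u1
  by (rule swap)

interpretation diag: m_pair z1 z1 \<eta>1 \<eta>1 v1 v1 u1 u1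
  using data1 z_bound(1) \<eta>_bound(1) by unfold_locales

lemma swap_num_den: "swap.num = num" "swap.den = den"
  by (simp_all add: num_def den_def swap.num_def swap.den_def norm_minus_commute)

text \<open>The cancellation behind the bound on \<open>M121\<close>: the products on the left are of order
  \<open>(num / den)\<^sup>2\<close> individually.\<close>

lemma x_product_diff:
  "x1 n A * swap.x1 n B - x2 n A * swap.x2 n B =
     (q1 n A * swap.q1 n B - q2 n A * swap.q2 n B) / of_real \<beta>"
proof -
  define k where "k = complex_of_real (v1 * v2)"
  define b where "b = complex_of_real \<beta>"
  have b: "b = (1 - \<kappa>) * (1 - cnj \<kappa>) - k\<^sup>2" "b \<noteq> 0"
    using \<beta>_ge(5) by (simp_all only: b_def k_def of_real_bet[symmetric] of_real_eq_0_iff)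
  have \<kappa>': "kap z2 u2 z1 u1 = cnj \<kappa>" by (simp add: kap_def mult_ac)
  define p1 p2 r1 r2 where "p1 = q1 n A" "p2 = q2 n A" "r1 = swap.q1 n B" "r2 = swap.q2 n B"
  have x: "x1 n A = ((1 - cnj \<kappa>) * p1 - k * p2) / b" "x2 n A = ((1 - \<kappa>) * p2 - k * p1) / b"
    "swap.x1 n B = ((1 - \<kappa>) * r1 - k * r2) / b" "swap.x2 n B = ((1 - cnj \<kappa>) * r2 - k * r1) / b"
    by (simp_all add: x1_def x2_def swap.x1_def swap.x2_def xs1_def xs2_def \<kappa>' bet_swap k_def b_def
        p1_p2_r1_r2_def mult.commute)
  \<comment> \<open>Exchanging the indices conjugates \<open>\<kappa>\<close>, so the cross terms in
    \<open>p1 * r2\<close> and \<open>p2 * r1\<close> cancel. What is left contains the determinant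
    as a factor, which removes one power of \<open>1 / \<beta>\<close>.\<close>
  have "((1 - cnj \<kappa>) * p1 - k * p2) * ((1 - \<kappa>) * r1 - k * r2) - ((1 - \<kappa>) * p2 - k * p1) * ((1 - cnj \<kappa>) * r2 - k * r1)
      = b * (p1 * r1 - p2 * r2)"
    unfolding b(1) by (simp add: algebra_simps power2_eq_square)
  then have "x1 n A * swap.x1 n B - x2 n A * swap.x2 n B = b * (p1 * r1 - p2 * r2) / (b * b)"
    unfolding x times_divide_times_eq diff_divide_distrib[symmetric] by (simp only:)
  then show ?thesis using b(2) by (simp add: b_def p1_p2_r1_r2_def)
qed

text \<open>For equal indices \<open>kap\<close> is the real number \<open>u1 - v1\<^sup>2\<close>.
  The system is then symmetric under exchange of the blocks, hence diagonal in sum and difference;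
  the denominators are its eigenvalues.\<close>

lemma diag_xs:
  "xs1 z1 v1 u1 z1 v1 u1 s r + xs2 z1 v1 u1 z1 v1 u1 s r = (s + r) / of_real ((1 - u1) + 2 * v1\<^sup>2)"
  "xs1 z1 v1 u1 z1 v1 u1 s r - xs2 z1 v1 u1 z1 v1 u1 s r = (s - r) / of_real (1 - u1)"
proof -
  have e: "(cmod z1)\<^sup>2 * u1\<^sup>2 = u1 - v1\<^sup>2" using data1 by (simp add: m_data_def)
  have "kap z1 u1 z1 u1 = of_real ((cmod z1)\<^sup>2 * u1\<^sup>2)"
    by (simp only: kap_def of_real_mult complex_norm_square power2_eq_square[of u1])
  then have k: "kap z1 u1 z1 u1 = of_real (u1 - v1\<^sup>2)" by (simp only: e)
  have b: "bet z1 v1 u1 z1 v1 u1 = (1 - u1) * ((1 - u1) + 2 * v1\<^sup>2)"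
  proof -
    have "cmod (1 - complex_of_real (u1 - v1\<^sup>2)) = \<bar>1 - (u1 - v1\<^sup>2)\<bar>"
      by (metis norm_of_real of_real_1 of_real_diff)
    then show ?thesis unfolding bet_def k by (simp add: algebra_simps power2_eq_square)
  qed
  have nz: "complex_of_real (1 - u1) \<noteq> 0" "complex_of_real ((1 - u1) + 2 * v1\<^sup>2) \<noteq> 0"
    unfolding of_real_eq_0_iff using u_range zero_le_power2[of v1] by linarith+
  define d e where "d = complex_of_real (1 - u1)" and "e = complex_of_real ((1 - u1) + 2 * v1\<^sup>2)"
  have c: "1 - complex_of_real (u1 - v1\<^sup>2) = (d + e) / 2" "complex_of_real (v1 * v1) = (e - d) / 2"
    "complex_of_real (bet z1 v1 u1 z1 v1 u1) = d * e"
    by (simp_all add: d_def e_def b power2_eq_square field_simps)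
  have "xs1 z1 v1 u1 z1 v1 u1 s r = ((d + e) / 2 * s - (e - d) / 2 * r) / (d * e)"
    "xs2 z1 v1 u1 z1 v1 u1 s r = ((d + e) / 2 * r - (e - d) / 2 * s) / (d * e)"
    unfolding xs1_def xs2_def k complex_cnj_complex_of_real c by simp_all
  moreover have "(d + e) / 2 * s - (e - d) / 2 * r + ((d + e) / 2 * r - (e - d) / 2 * s) = d * (s + r)"
    "(d + e) / 2 * s - (e - d) / 2 * r - ((d + e) / 2 * r - (e - d) / 2 * s) = e * (s - r)"
    by (simp_all add: field_simps)
  ultimately show "xs1 z1 v1 u1 z1 v1 u1 s r + xs2 z1 v1 u1 z1 v1 u1 s r = (s + r) / of_real ((1 - u1) + 2 * v1\<^sup>2)"
    "xs1 z1 v1 u1 z1 v1 u1 s r - xs2 z1 v1 u1 z1 v1 u1 s r = (s - r) / of_real (1 - u1)"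
    using nz unfolding d_def[symmetric] e_def[symmetric]
    by (simp_all only: add_divide_distrib[symmetric] diff_divide_distrib[symmetric]) simp_all
qed

text \<open>Both products collapse by \<open>|z1|\<^sup>2 u1\<^sup>2 = u1 - v1\<^sup>2\<close>. The
  first is diagonal with opposite entries, so its trace sees just the difference in
  \<open>x_product_diff\<close>; the off-diagonal blocks of the second carry a factor
  \<open>v1\<close>.\<close>

lemma P_E_P:
  "P n * E_minus n * P n = blk n (- of_real u1) 0 0 (of_real u1)"
  "P n * E_plus n * P n = blk n (of_real (u1 - 2 * v1\<^sup>2)) (- 2 * \<i> * of_real (v1 * u1) * z1)
     (- 2 * \<i> * of_real (v1 * u1) * cnj z1) (of_real (u1 - 2 * v1\<^sup>2))"
proof -
  have "(cmod z1)\<^sup>2 * u1\<^sup>2 = u1 - v1\<^sup>2" using data1 by (simp add: m_data_def)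
  then have "z1 * cnj z1 * of_real (u1\<^sup>2) = of_real (u1 - v1\<^sup>2)"
    by (metis complex_norm_square of_real_mult)
  then have e: "z1 * of_real u1 * (cnj z1 * of_real u1) = of_real u1 - (of_real v1)\<^sup>2"
    "cnj z1 * of_real u1 * (z1 * of_real u1) = of_real u1 - (of_real v1)\<^sup>2"
    by (simp_all add: power2_eq_square mult_ac)
  have i: "\<i> * complex_of_real v1 * (\<i> * complex_of_real v1) = - (of_real v1)\<^sup>2"
  proof -
    have "\<i> * complex_of_real v1 * (\<i> * complex_of_real v1) = (\<i> * \<i>) * (complex_of_real v1)\<^sup>2"
      by (simp only: power2_eq_square mult_ac)
    then show ?thesis by simp
  qed
  show "P n * E_minus n * P n = blk n (- of_real u1) 0 0 (of_real u1)"
    unfolding mb_def E_minus_blk by (simp add: e i)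
  show "P n * E_plus n * P n = blk n (of_real (u1 - 2 * v1\<^sup>2)) (- 2 * \<i> * of_real (v1 * u1) * z1)
     (- 2 * \<i> * of_real (v1 * u1) * cnj z1) (of_real (u1 - 2 * v1\<^sup>2))"
    unfolding mb_def E_plus_blk by (simp add: e i) (simp add: power2_eq_square algebra_simps)
qed

text \<open>The outer inversion costs \<open>1 / (1 - u1)\<close> on the trace against
  \<open>E_minus\<close>. This is at most \<open>221 * |v1| / \<eta>min\<close>, and its
  \<open>|v1|\<close> meets the \<open>|v2|\<close> left by the cancellation, with
  \<open>|v1| |v2| \<le> num\<close>. Against \<open>E_plus\<close> the cost is
  \<open>1 / (1 - u1 + 2 v1\<^sup>2)\<close>, which \<open>v_\<eta>min_num_le\<close> is made
  for.\<close>

lemma op_norm_M121_le: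
  assumes n: "n \<ge> 1" and A: "A \<in> cmat n" "op_norm A \<le> a" and B: "B \<in> cmat n" "op_norm B \<le> a"
    and a: "1 \<le> a"
  shows "op_norm (M121 n (\<i> * of_real \<eta>1) z1 (\<i> * of_real \<eta>2) z2 A B) \<le> 10 ^ 60 * a\<^sup>2 * (num / den) / \<eta>min"
proof -
  define R where "R = num / den"
  have R: "0 < R" "1 \<le> 221 * R" using num_pos den_pos one_le_num_div_den by (auto simp: R_def)
  define X where "X = 10 ^ 15 * a * R"
  have X: "0 \<le> X" using a R by (simp add: X_def)
  define S T where "S = blk n (x2 n A) 0 0 (x1 n A)" and "T = blk n (swap.x2 n B) 0 0 (swap.x1 n B)"
  have x: "cmod (x1 n A) \<le> X" "cmod (x2 n A) \<le> X" "cmod (swap.x1 n B) \<le> X" "cmod (swap.x2 n B) \<le> X"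
    using cmod_x_le[OF A] swap.cmod_x_le[OF B] unfolding X_def R_def swap_num_den by auto
  have ST: "S \<in> cmat n" "T \<in> cmat n" "op_norm S \<le> 2 * X" "op_norm T \<le> 2 * X"
    using op_norm_blk[of n "x2 n A" 0 0 "x1 n A"] op_norm_blk[of n "swap.x2 n B" 0 0 "swap.x1 n B"] x
    unfolding S_def T_def by auto
  define \<eta> where "\<eta> = \<eta>min"
  have \<eta>: "0 < \<eta>" "\<eta> \<le> \<bar>\<eta>1\<bar>" using \<eta>_nz by (auto simp: \<eta>_def)
  let ?P = "P n" and ?Q = "Q n"
  define Y where "Y = ?P * (A + S) * (?Q * (B + T)) * ?P"
  have Ycar: "Y \<in> cmat n" unfolding Y_def using A B ST by simp
  let ?s = "btr1 n Y" and ?t = "btr2 n Y"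
  define y1 y2 where "y1 = xs1 z1 v1 u1 z1 v1 u1 ?s ?t" and "y2 = xs2 z1 v1 u1 z1 v1 u1 ?s ?t"
  have M121: "M121 n (\<i> * of_real \<eta>1) z1 (\<i> * of_real \<eta>2) z2 A B = Y + ?P * blk n y2 0 0 y1 * ?P"
  proof -
    have M21: "M12 n (\<i> * of_real \<eta>2) z2 (\<i> * of_real \<eta>1) z1 B = ?Q * (B + T) * ?P"
      unfolding swap.M12_eq(1)[OF n B(1)] T_def[symmetric] using B(1) ST
      by (simp add: mult_add_distrib_mat[of _ "2 * n" "2 * n" _ "2 * n"]
          add_mult_distrib_mat[of _ "2 * n" "2 * n" _ _ "2 * n"])
    have "?P * A * G + ?P * S * G = ?P * (A + S) * G" if "G \<in> cmat n" for G
      using A(1) ST that by (simp add: mult_add_distrib_mat[of _ "2 * n" "2 * n" _ "2 * n"]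
          add_mult_distrib_mat[of _ "2 * n" "2 * n" _ _ "2 * n"])
    then have "?P * A * (?Q * (B + T) * ?P) + ?P * S * (?Q * (B + T) * ?P) = ?P * (A + S) * (?Q * (B + T) * ?P)"
      using B(1) ST by simp
    also have "\<dots> = Y" unfolding Y_def using A(1) B(1) ST
      by (intro assoc_cmat[of _ n, symmetric]) auto
    finally show ?thesis
      unfolding M121_def M21 M12_eq(2)[OF n A(1)] S_def[symmetric] M_mat_mb[OF data1]
      using B_inv_mb(1)[OF n _ Ycar, of z1 v1 u1 z1 v1 u1] diag.\<beta>_ge(5) by (simp add: y1_def y2_def)
  qed
  have AS: "op_norm (A + S) \<le> a + 2 * X" "op_norm (B + T) \<le> a + 2 * X"
    using op_norm_add[of A "2 * n" "2 * n" S] op_norm_add[of B "2 * n" "2 * n" T] A B ST by auto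
  have aX: "a + 2 * X \<le> 10 ^ 16 * (a * R)"
  proof -
    have "a * 1 \<le> a * (221 * R)" using R a by (intro mult_left_mono) auto
    then show ?thesis using a R by (simp add: X_def)
  qed
  have Ynorm: "op_norm Y \<le> 10 ^ 40 * (a\<^sup>2 * R / \<eta>)"
  proof -
    have "op_norm Y \<le> 22 * (10 ^ 16 * (a * R)) * (22 * (10 ^ 16 * (a * R))) * 22"
      unfolding Y_def using A B ST order_trans[OF AS(1) aX] order_trans[OF AS(2) aX] op_norm_mb
      by (intro op_norm_mult_le[where n = n] cmat_mult) auto
    also have "\<dots> = 10648 * 10 ^ 32 * (a\<^sup>2 * R * R)" by (simp add: power2_eq_square)
    also have "\<dots> \<le> 10648 * 10 ^ 32 * (a\<^sup>2 * R * (442 / \<eta>))"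
    proof -
      have "\<eta> * R \<le> 442" using \<eta>min_num_le den_pos by (simp add: R_def \<eta>_def divide_le_eq)
      then have "R \<le> 442 / \<eta>" using \<eta> by (simp add: field_simps)
      then show ?thesis using R by (intro mult_left_mono) auto
    qed
    also have "\<dots> = 10648 * 10 ^ 32 * 442 * (a\<^sup>2 * R / \<eta>)" by simp
    also have "\<dots> \<le> 10 ^ 40 * (a\<^sup>2 * R / \<eta>)" using R \<eta> by (intro mult_right_mono) auto
    finally show ?thesis .
  qed
  \<comment> \<open>Of the four terms of \<open>(A + S) Q (B + T)\<close> only \<open>S Q T\<close>
    has two factors of order \<open>R\<close>. It is kept for separate treatment at each
    \<open>E\<close>; the others are of order \<open>R\<close>.\<close>
  have tr: "cmod (ntrace n (Y * E)) \<le> 10 ^ 21 * (a\<^sup>2 * R) + cmod (ntrace n (S * ?Q * T * (?P * E * ?P)))"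
    if E: "E \<in> cmat n" "op_norm E \<le> 2" for E
  proof -
    define F where "F = ?P * E * ?P"
    have F: "F \<in> cmat n" "op_norm F \<le> 968"
    proof -
      have "op_norm F \<le> 22 * 2 * 22" unfolding F_def using E op_norm_mb by (intro op_norm_mult_le[where n = n]) auto
      then show "F \<in> cmat n" "op_norm F \<le> 968" using E by (auto simp: F_def)
    qed
    have "ntrace n (Y * E) = ntrace n ((A + S) * (?Q * (B + T)) * F)"
    proof -
      define G where "G = (A + S) * (?Q * (B + T))"
      have G: "G \<in> cmat n" unfolding G_def using A B ST by auto
      have "Y * E = ?P * G * ?P * E"
        unfolding Y_def G_def using A B ST assoc_cmat[of ?P n "A + S" "?Q * (B + T)"] by simp
      also have "\<dots> = ?P * (G * ?P * E)"
        using G E assoc_cmat[of ?P n G ?P] assoc_cmat[of ?P n "G * ?P" E] by simp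
      finally have "ntrace n (Y * E) = ntrace n (G * ?P * E * ?P)"
        using ntrace_mult_commute[of ?P n "G * ?P * E"] G E by simp
      also have "G * ?P * E * ?P = G * F"
        unfolding F_def using G E assoc_cmat[of G n ?P E] assoc_cmat[of G n "?P * E" ?P] by simp
      finally show ?thesis by (simp add: G_def)
    qed
    also have "(A + S) * (?Q * (B + T)) * F
        = A * (?Q * (B + T)) * F + (S * (?Q * B) * F + S * ?Q * T * F)"
    proof -
      have "(A + S) * (?Q * (B + T)) * F = A * (?Q * (B + T)) * F + S * (?Q * (B + T)) * F"
        using A B ST F by (simp add: add_mult_distrib_mat[of _ "2 * n" "2 * n" _ _ "2 * n"])
      moreover have "S * (?Q * (B + T)) * F = S * (?Q * B) * F + S * (?Q * T) * F"
        using A B ST F by (simp add: mult_add_distrib_mat[of _ "2 * n" "2 * n" _ "2 * n"]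
          add_mult_distrib_mat[of _ "2 * n" "2 * n" _ _ "2 * n"])
      moreover have "S * (?Q * T) = S * ?Q * T" using ST assoc_cmat[of S n ?Q T] by simp
      ultimately show ?thesis by simp
    qed
    also have "ntrace n \<dots> = ntrace n (A * (?Q * (B + T)) * F) + (ntrace n (S * (?Q * B) * F) + ntrace n (S * ?Q * T * F))"
      using A B ST F by (simp add: ntrace_add)
    also have "cmod \<dots> \<le> cmod (ntrace n (A * (?Q * (B + T)) * F)) + (cmod (ntrace n (S * (?Q * B) * F)) + cmod (ntrace n (S * ?Q * T * F)))"
      by (intro norm_triangle_mono norm_triangle_ineq) auto
    finally have 1: "cmod (ntrace n (Y * E)) \<le> \<dots>" .
    have "op_norm (A * (?Q * (B + T)) * F) \<le> a * (22 * (10 ^ 16 * (a * R))) * 968"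
      using A B ST F order_trans[OF AS(2) aX] op_norm_mb by (intro op_norm_mult_le[where n = n] cmat_mult) auto
    then have 2: "cmod (ntrace n (A * (?Q * (B + T)) * F)) \<le> a * (22 * (10 ^ 16 * (a * R))) * 968"
      using cmod_ntrace_le[of "A * (?Q * (B + T)) * F" n] A B ST F by simp
    have "op_norm (S * (?Q * B) * F) \<le> 2 * X * (22 * a) * 968"
      using A B ST F op_norm_mb by (intro op_norm_mult_le[where n = n] cmat_mult) auto
    then have 3: "cmod (ntrace n (S * (?Q * B) * F)) \<le> 2 * X * (22 * a) * 968"
      using cmod_ntrace_le[of "S * (?Q * B) * F" n] A B ST F by simp
    have "a * (22 * (10 ^ 16 * (a * R))) * 968 + 2 * X * (22 * a) * 968
        = (22 * 968 * 10 ^ 16 + 2 * 22 * 968 * 10 ^ 15) * (a\<^sup>2 * R)"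
      by (simp add: X_def power2_eq_square)
    also have "\<dots> \<le> 10 ^ 21 * (a\<^sup>2 * R)" using R by (intro mult_right_mono) auto
    finally show ?thesis using 1 2 3 unfolding F_def by linarith
  qed
  have Epm: "E_plus n \<in> cmat n" "op_norm (E_plus n) \<le> 2" "E_minus n \<in> cmat n" "op_norm (E_minus n) \<le> 2"
    using op_norm_blk[of n 1 0 0 1] op_norm_blk[of n 1 0 0 "-1"] by (auto simp: E_plus_blk E_minus_blk)
  have minus: "cmod (y1 - y2) \<le> 10 ^ 26 * (a\<^sup>2 * R / \<eta>)"
  proof -
    have "ntrace n (S * ?Q * T * (?P * E_minus n * ?P))
        = \<i> * of_real (v2 * u1) * (x1 n A * swap.x1 n B - x2 n A * swap.x2 n B) / 2"
      unfolding P_E_P unfolding S_def T_def mb_def using n by (simp add: ntrace_blk) (simp add: algebra_simps)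
    also have "\<dots> = \<i> * of_real (v2 * u1) * ((q1 n A * swap.q1 n B - q2 n A * swap.q2 n B) / of_real \<beta>) / 2"
      unfolding x_product_diff ..
    finally have "cmod (ntrace n (S * ?Q * T * (?P * E_minus n * ?P)))
        = \<bar>v2\<bar> * u1 * (cmod (q1 n A * swap.q1 n B - q2 n A * swap.q2 n B) / \<beta>) / 2"
      using \<beta>_ge(5) u_range by (simp add: norm_mult norm_divide)
    also have "\<dots> \<le> \<bar>v2\<bar> * 1 * ((2 * (1936 * a)\<^sup>2) / \<beta>) / 2"
    proof -
      have "cmod (q1 n A * swap.q1 n B - q2 n A * swap.q2 n B)
          \<le> cmod (q1 n A * swap.q1 n B) + cmod (q2 n A * swap.q2 n B)" by (rule norm_triangle_ineq4)
      also have "\<dots> \<le> (1936 * a) * (1936 * a) + (1936 * a) * (1936 * a)"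
        unfolding norm_mult using cmod_q_le[OF A] swap.cmod_q_le[OF B] a
        by (intro add_mono mult_mono) auto
      finally have "cmod (q1 n A * swap.q1 n B - q2 n A * swap.q2 n B) \<le> 2 * (1936 * a)\<^sup>2"
        by (simp add: power2_eq_square)
      then show ?thesis
        using u_range \<beta>_ge(5) by (intro divide_right_mono mult_mono) auto
    qed
    also have "\<dots> = 1936\<^sup>2 * a\<^sup>2 * \<bar>v2\<bar> / \<beta>" by (simp add: power_mult_distrib)
    also have "\<dots> \<le> 1936\<^sup>2 * a\<^sup>2 * \<bar>v2\<bar> / (den / 10 ^ 9)"
      using den_le den_pos \<beta>_ge(5) by (intro divide_left_mono) auto
    also have "\<dots> = 1936\<^sup>2 * 10 ^ 9 * (a\<^sup>2 * (\<bar>v2\<bar> / den))" by simp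
    finally have q: "cmod (ntrace n (S * ?Q * T * (?P * E_minus n * ?P))) \<le> \<dots>" .
    have t: "cmod (ntrace n (Y * E_minus n)) \<le> 10 ^ 21 * (a\<^sup>2 * R) + 1936\<^sup>2 * 10 ^ 9 * (a\<^sup>2 * (\<bar>v2\<bar> / den))"
      using tr[OF Epm(3,4)] q by linarith
    have v: "\<bar>v1\<bar> * cmod (ntrace n (Y * E_minus n)) \<le> 10 ^ 22 * (a\<^sup>2 * R)"
    proof -
      have "\<bar>v1\<bar> * cmod (ntrace n (Y * E_minus n))
          \<le> \<bar>v1\<bar> * (10 ^ 21 * (a\<^sup>2 * R) + 1936\<^sup>2 * 10 ^ 9 * (a\<^sup>2 * (\<bar>v2\<bar> / den)))"
        using t by (intro mult_left_mono) auto
      also have "\<dots> = \<bar>v1\<bar> * (10 ^ 21 * (a\<^sup>2 * R)) + 1936\<^sup>2 * 10 ^ 9 * (a\<^sup>2 * ((\<bar>v1\<bar> * \<bar>v2\<bar>) / den))"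
        by (simp add: distrib_left)
      also have "\<dots> \<le> 1 * (10 ^ 21 * (a\<^sup>2 * R)) + 1936\<^sup>2 * 10 ^ 9 * (a\<^sup>2 * (num / den))"
        using v_range v_le_num den_pos R by (intro add_mono mult_right_mono mult_left_mono divide_right_mono) auto
      also have "\<dots> = (10 ^ 21 + 1936\<^sup>2 * 10 ^ 9) * (a\<^sup>2 * R)" by (simp add: R_def)
      also have "\<dots> \<le> 10 ^ 22 * (a\<^sup>2 * R)" using R by (intro mult_right_mono) auto
      finally show ?thesis .
    qed
    have inv_d: "1 / (1 - u1) \<le> 221 * \<bar>v1\<bar> / \<eta>"
    proof -
      have "\<eta> * 1 \<le> 221 * ((1 - u1) * \<bar>v1\<bar>)" using \<eta>(2) \<eta>_le(1) by linarith
      then show ?thesis using \<eta>(1) u_range by (simp add: field_simps)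
    qed
    have "?s - ?t = 2 * ntrace n (Y * E_minus n)" by (simp add: btr1_def btr2_def)
    then have "y1 - y2 = 2 * ntrace n (Y * E_minus n) / of_real (1 - u1)"
      unfolding y1_def y2_def diag_xs by (simp only:)
    then have "cmod (y1 - y2) = 2 * cmod (ntrace n (Y * E_minus n)) * (1 / (1 - u1))"
      using u_range by (simp only: norm_divide norm_mult norm_of_real) simp
    also have "\<dots> \<le> 2 * cmod (ntrace n (Y * E_minus n)) * (221 * \<bar>v1\<bar> / \<eta>)"
      using inv_d by (intro mult_left_mono) auto
    also have "\<dots> = 442 * (\<bar>v1\<bar> * cmod (ntrace n (Y * E_minus n))) / \<eta>" by simp
    also have "\<dots> \<le> 442 * (10 ^ 22 * (a\<^sup>2 * R)) / \<eta>"
      using v \<eta> by (intro divide_right_mono mult_left_mono) auto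
    also have "\<dots> = 442 * 10 ^ 22 * (a\<^sup>2 * R / \<eta>)" by simp
    also have "\<dots> \<le> 10 ^ 26 * (a\<^sup>2 * R / \<eta>)" using R \<eta> by (intro mult_right_mono) auto
    finally show ?thesis .
  qed
  have plus: "cmod (y1 + y2) \<le> 10 ^ 50 * (a\<^sup>2 * R / \<eta>)"
  proof -
    define w where "w = \<bar>v1\<bar> + \<bar>v2\<bar>"
    define f g h where "f = complex_of_real (u1 - 2 * v1\<^sup>2)" and "g = - 2 * \<i> * of_real (v1 * u1) * z1"
      and "h = - 2 * \<i> * of_real (v1 * u1) * cnj z1"
    have f: "cmod f \<le> 2"
    proof -
      have "v1\<^sup>2 \<le> 1" using v_range by (simp add: abs_square_le_1)
      then show ?thesis unfolding f_def norm_of_real using u_range zero_le_power2[of v1] by linarith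
    qed
    have gh: "cmod g \<le> 20 * \<bar>v1\<bar>" "cmod h \<le> 20 * \<bar>v1\<bar>"
    proof -
      have "u1 * (\<bar>v1\<bar> * cmod z1) \<le> 1 * (\<bar>v1\<bar> * 10)" using u_range z_bound by (intro mult_mono) auto
      then show "cmod g \<le> 20 * \<bar>v1\<bar>" "cmod h \<le> 20 * \<bar>v1\<bar>" using u_range
        by (simp_all add: g_def h_def norm_mult mult.commute mult.left_commute)
    qed
    have uz: "cmod z2 * u2 \<le> 10" using mult_mono[of "cmod z2" 10 u2 1] u_range z_bound by simp
    \<comment> \<open>Every term contains \<open>v1\<close> or \<open>v2\<close>: the diagonal
      blocks of \<open>Q\<close> carry \<open>v2\<close>, and its off-diagonal blocks meet only
      \<open>g\<close> and \<open>h\<close>, which carry \<open>v1\<close>.\<close>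
    have "ntrace n (S * ?Q * T * (?P * E_plus n * ?P))
        = (x2 n A * (\<i> * of_real v2) * swap.x2 n B * f + x2 n A * (- z2 * of_real u2) * swap.x1 n B * h
          + (x1 n A * (- cnj z2 * of_real u2) * swap.x2 n B * g + x1 n A * (\<i> * of_real v2) * swap.x1 n B * f)) / 2"
      unfolding P_E_P unfolding S_def T_def mb_def f_def[symmetric] g_def[symmetric] h_def[symmetric]
      using n by (simp add: ntrace_blk)
    also have "cmod \<dots> \<le> (X * \<bar>v2\<bar> * X * 2 + X * 10 * X * (20 * \<bar>v1\<bar>) + (X * 10 * X * (20 * \<bar>v1\<bar>) + X * \<bar>v2\<bar> * X * 2)) / 2"
      unfolding norm_divide
    proof (rule frac_le)
      have m: "cmod (p * q * r * s) \<le> p' * q' * r' * s'"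
        if "cmod p \<le> p'" "cmod q \<le> q'" "cmod r \<le> r'" "cmod s \<le> s'" for p q r s p' q' r' s'
        unfolding norm_mult using that by (intro mult_mono) (auto intro: order_trans[OF norm_ge_zero] mult_nonneg_nonneg)
      show "cmod (x2 n A * (\<i> * of_real v2) * swap.x2 n B * f + x2 n A * (- z2 * of_real u2) * swap.x1 n B * h
          + (x1 n A * (- cnj z2 * of_real u2) * swap.x2 n B * g + x1 n A * (\<i> * of_real v2) * swap.x1 n B * f))
        \<le> X * \<bar>v2\<bar> * X * 2 + X * 10 * X * (20 * \<bar>v1\<bar>) + (X * 10 * X * (20 * \<bar>v1\<bar>) + X * \<bar>v2\<bar> * X * 2)"
        by (intro norm_triangle_mono m) (use x f gh uz u_range in \<open>auto simp: norm_mult\<close>)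
    qed (use X in auto)
    also have "\<dots> = 2 * \<bar>v2\<bar> * X\<^sup>2 + 200 * \<bar>v1\<bar> * X\<^sup>2" by (simp add: power2_eq_square)
    also have "\<dots> \<le> 200 * \<bar>v2\<bar> * X\<^sup>2 + 200 * \<bar>v1\<bar> * X\<^sup>2" by (intro add_mono mult_right_mono) auto
    also have "\<dots> = 200 * w * X\<^sup>2" by (simp add: w_def algebra_simps)
    also have "\<dots> = 200 * 10 ^ 30 * (a\<^sup>2 * R * (w * R))" by (simp add: X_def power2_eq_square)
    finally have t: "cmod (ntrace n (Y * E_plus n)) \<le> 10 ^ 21 * (a\<^sup>2 * R) + 200 * 10 ^ 30 * (a\<^sup>2 * R * (w * R))"
      using tr[OF Epm(1,2)] by linarith
    define d where "d = (1 - u1) + 2 * v1\<^sup>2"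
    \<comment> \<open>The last two bounds pay for \<open>1 / d\<close>: they turn the two terms
      bounding the trace into multiples of \<open>a\<^sup>2 * R / \<eta>\<close>.\<close>
    have d: "0 < d" "\<eta> \<le> 221 * d" "\<eta> * (w * R) \<le> 10 ^ 14 * d"
    proof -
      show "0 < d" using u_range zero_le_power2[of v1] unfolding d_def by linarith
      have "(1 - u1) * \<bar>v1\<bar> \<le> 1 - u1" using u_range v_range by (simp add: mult_left_le)
      then have "(1 - u1) * \<bar>v1\<bar> \<le> d" using zero_le_power2[of v1] unfolding d_def by linarith
      then show "\<eta> \<le> 221 * d" using \<eta>(2) \<eta>_le(1) by linarith
      have "\<eta> * (w * R) = w * \<eta>min * num / den" by (simp add: R_def \<eta>_def)
      also have "\<dots> \<le> 10 ^ 14 * (((1 - u1) + v1\<^sup>2) * den) / den"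
        unfolding w_def using v_\<eta>min_num_le den_pos by (intro divide_right_mono) auto
      also have "\<dots> = 10 ^ 14 * ((1 - u1) + v1\<^sup>2)" using den_pos by simp
      also have "\<dots> \<le> 10 ^ 14 * d" by (simp add: d_def)
      finally show "\<eta> * (w * R) \<le> 10 ^ 14 * d" .
    qed
    have "?s + ?t = 2 * ntrace n (Y * E_plus n)" by (simp add: btr1_def btr2_def)
    then have "y1 + y2 = 2 * ntrace n (Y * E_plus n) / of_real d"
      unfolding y1_def y2_def diag_xs d_def by (simp only:)
    then have "cmod (y1 + y2) = 2 * cmod (ntrace n (Y * E_plus n)) / d"
      using d(1) by (simp only: norm_divide norm_mult norm_of_real) simp
    also have "\<dots> \<le> 2 * (10 ^ 21 * (a\<^sup>2 * R) + 200 * 10 ^ 30 * (a\<^sup>2 * R * (w * R))) / d"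
      using t d(1) by (intro divide_right_mono mult_left_mono) auto
    also have "\<dots> = (2 * 10 ^ 21 * (a\<^sup>2 * R) * \<eta> + 400 * 10 ^ 30 * (a\<^sup>2 * R) * (\<eta> * (w * R))) / (\<eta> * d)"
      using \<eta>(1) d(1) by (simp add: field_simps)
    also have "\<dots> \<le> (2 * 10 ^ 21 * (a\<^sup>2 * R) * (221 * d) + 400 * 10 ^ 30 * (a\<^sup>2 * R) * (10 ^ 14 * d)) / (\<eta> * d)"
      using \<eta> d R by (intro divide_right_mono add_mono mult_left_mono) auto
    also have "\<dots> = (442 * 10 ^ 21 + 400 * 10 ^ 44) * (a\<^sup>2 * R / \<eta>)"
      using d(1) \<eta>(1) by (simp add: field_simps)
    also have "\<dots> \<le> 10 ^ 50 * (a\<^sup>2 * R / \<eta>)" using R \<eta> by (intro mult_right_mono) auto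
    finally show ?thesis .
  qed
  define Z where "Z = a\<^sup>2 * R / \<eta>"
  have Z: "0 \<le> Z" using R \<eta> by (simp add: Z_def)
  have "cmod (y1 + y2) + cmod (y1 - y2) \<le> 10 ^ 51 * Z"
  proof -
    have "10 ^ 50 * Z + 10 ^ 26 * Z \<le> 10 ^ 51 * Z" using Z by simp
    then show ?thesis using minus plus unfolding Z_def[symmetric] by linarith
  qed
  moreover have "2 * cmod y1 \<le> cmod (y1 + y2) + cmod (y1 - y2)" "2 * cmod y2 \<le> cmod (y1 + y2) + cmod (y1 - y2)"
    using norm_triangle_ineq[of "y1 + y2" "y1 - y2"] norm_triangle_ineq4[of "y1 + y2" "y1 - y2"] by auto
  ultimately have y: "cmod y1 \<le> 10 ^ 51 * Z" "cmod y2 \<le> 10 ^ 51 * Z"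
    using norm_ge_zero[of y1] norm_ge_zero[of y2] by linarith+
  have "op_norm (M121 n (\<i> * of_real \<eta>1) z1 (\<i> * of_real \<eta>2) z2 A B) \<le> op_norm Y + op_norm (?P * blk n y2 0 0 y1 * ?P)"
    unfolding M121 using Ycar by (intro op_norm_add[of _ "2 * n" "2 * n"]) auto
  also have "\<dots> \<le> 10 ^ 40 * Z + 968 * (10 ^ 51 * Z)"
    using Ynorm diag.op_norm_P_diag_Q[OF y(2,1)] unfolding Z_def[symmetric] by (intro add_mono) auto
  also have "\<dots> \<le> 10 ^ 60 * Z" using Z by simp
  finally show ?thesis by (simp add: Z_def R_def \<eta>_def)
qed

section \<open>Comparison with gamma_hat and gamma_ctrl\<close>

lemma rho_eq: "rho z1 \<eta>1 = \<bar>v1\<bar> / pi" "rho z2 \<eta>2 = \<bar>v2\<bar> / pi"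
  unfolding rho_def m_data_sol(1)[OF data1] m_data_sol(1)[OF data2] by simp_all

text \<open>In modulus \<open>\<eta> / rho\<close> is \<open>pi |\<eta>| / |v|\<close>, at most
  \<open>221 pi (1 - u)\<close> by \<open>\<eta>_le\<close>; and \<open>16 * 221\<^sup>2\<close> is
  below \<open>10 ^ 6\<close>.\<close>

lemma gamma_hat_le: "gamma_hat \<eta>1 z1 \<eta>2 z2 \<le> 10 ^ 6 * den"
  and gamma_hat_pos: "0 < gamma_hat \<eta>1 z1 \<eta>2 z2"
proof -
  have pi: "1 \<le> pi" "pi\<^sup>2 \<le> 16"
    using pi_ge_two pi_less_4 power_mono[of pi 4 2] by auto
  have 1: "\<bar>v\<bar> / pi * \<bar>\<eta>\<bar> \<le> \<bar>v\<bar> * \<bar>\<eta>\<bar>" for v \<eta> :: real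
    using pi mult_left_mono[of 1 pi "\<bar>v\<bar> * \<bar>\<eta>\<bar>"] by (simp add: field_simps)
  have 2: "(\<eta> / (\<bar>v\<bar> / pi))\<^sup>2 \<le> 16 * 221\<^sup>2 * (1 - u)\<^sup>2"
    if "\<bar>\<eta>\<bar> \<le> 221 * ((1 - u) * \<bar>v\<bar>)" "0 < \<bar>v\<bar>" for \<eta> v u :: real
  proof -
    have "\<bar>\<eta>\<bar> / \<bar>v\<bar> \<le> 221 * (1 - u)" using that by (simp only: pos_divide_le_eq mult.assoc)
    then have "(\<bar>\<eta>\<bar> / \<bar>v\<bar>)\<^sup>2 \<le> (221 * (1 - u))\<^sup>2" by (intro power_mono) auto
    then have "pi\<^sup>2 * (\<bar>\<eta>\<bar> / \<bar>v\<bar>)\<^sup>2 \<le> 16 * (221 * (1 - u))\<^sup>2" using pi by (intro mult_mono) auto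
    moreover have "(\<eta> / (\<bar>v\<bar> / pi))\<^sup>2 = pi\<^sup>2 * (\<bar>\<eta>\<bar> / \<bar>v\<bar>)\<^sup>2"
      by (simp add: power_mult_distrib power_divide)
    ultimately show ?thesis by (simp only: power_mult_distrib mult.assoc)
  qed
  have "gamma_hat \<eta>1 z1 \<eta>2 z2 \<le> t\<^sup>2 + \<bar>v1\<bar> * \<bar>\<eta>1\<bar> + \<bar>v2\<bar> * \<bar>\<eta>2\<bar>
      + 16 * 221\<^sup>2 * (1 - u1)\<^sup>2 + 16 * 221\<^sup>2 * (1 - u2)\<^sup>2"
    unfolding gamma_hat_def rho_eq using \<eta>_le v_range by (intro add_mono 1 2) auto
  also have "\<dots> \<le> 10 ^ 6 * den"
    unfolding den_def by (simp add: distrib_left add_mono)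
  finally show "gamma_hat \<eta>1 z1 \<eta>2 z2 \<le> 10 ^ 6 * den" .
  have "0 < \<bar>v1\<bar> / pi * \<bar>\<eta>1\<bar>" "0 < \<bar>v2\<bar> / pi * \<bar>\<eta>2\<bar>" using v_range \<eta>_nz pi by simp_all
  then show "0 < gamma_hat \<eta>1 z1 \<eta>2 z2"
    unfolding gamma_hat_def rho_eq by (intro add_pos_nonneg add_nonneg_pos) auto
qed

text \<open>The numerator needs the comparison in the other direction,
  \<open>1 - u \<le> |\<eta>| / |v|\<close>, which follows from
  \<open>u |\<eta>| = (1 - u) |v|\<close> and \<open>u < 1\<close>.\<close>

lemma num_div_den_le: "num / den \<le> 10 ^ 8 * (1 / gamma_ctrl \<eta>1 z1 \<eta>2 z2)"
proof -
  let ?D = "t + (\<bar>v1\<bar> / pi)\<^sup>2 + (\<bar>v2\<bar> / pi)\<^sup>2 + \<bar>\<eta>1\<bar> / (\<bar>v1\<bar> / pi) + \<bar>\<eta>2\<bar> / (\<bar>v2\<bar> / pi)"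
  have pi: "1 \<le> pi" "pi\<^sup>2 \<le> 16"
    using pi_ge_two pi_less_4 power_mono[of pi 4 2] by auto
  have v: "v\<^sup>2 \<le> 16 * (\<bar>v\<bar> / pi)\<^sup>2" for v :: real
    using mult_right_mono[OF pi(2), of "v\<^sup>2"] by (simp add: field_simps power_divide)
  have d: "1 - u \<le> 16 * (\<bar>\<eta>\<bar> / (\<bar>v\<bar> / pi))"
    if "u * \<bar>\<eta>\<bar> = (1 - u) * \<bar>v\<bar>" "0 < \<bar>v\<bar>" "u < 1" for \<eta> v u :: real
  proof -
    have "(1 - u) * \<bar>v\<bar> \<le> 1 * \<bar>\<eta>\<bar>" unfolding that(1)[symmetric] using that by (intro mult_right_mono) auto
    then have "1 - u \<le> \<bar>\<eta>\<bar> / \<bar>v\<bar>" using that(2) by (simp add: le_divide_eq)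
    also have "\<dots> * 1 \<le> \<bar>\<eta>\<bar> / \<bar>v\<bar> * (16 * pi)" using pi by (intro mult_left_mono) auto
    finally show ?thesis by (simp add: mult_ac)
  qed
  have "num \<le> 16 * t + 16 * (\<bar>v1\<bar> / pi)\<^sup>2 + 16 * (\<bar>v2\<bar> / pi)\<^sup>2
      + 16 * (\<bar>\<eta>1\<bar> / (\<bar>v1\<bar> / pi)) + 16 * (\<bar>\<eta>2\<bar> / (\<bar>v2\<bar> / pi))"
    unfolding num_def using u_\<eta> v_range u_range by (intro add_mono v d) auto
  also have "\<dots> = 16 * ?D" by simp
  finally have D: "num \<le> 16 * ?D" .
  have D0: "0 \<le> ?D" using num_pos D by simp
  have "num / den \<le> 16 * ?D / (gamma_hat \<eta>1 z1 \<eta>2 z2 / 10 ^ 6)"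
    using D D0 gamma_hat_pos gamma_hat_le den_pos by (intro frac_le) auto
  also have "\<dots> = 16 * 10 ^ 6 * (?D / gamma_hat \<eta>1 z1 \<eta>2 z2)" by simp
  also have "\<dots> \<le> 10 ^ 8 * (?D / gamma_hat \<eta>1 z1 \<eta>2 z2)"
    using D0 gamma_hat_pos by (intro mult_right_mono) auto
  finally show ?thesis by (simp add: gamma_ctrl_def rho_eq)
qed

lemma vv_div_den_le: "\<bar>v1\<bar> * \<bar>v2\<bar> / den \<le> 10 ^ 8 * (rho z1 \<eta>1 * rho z2 \<eta>2 / gamma_hat \<eta>1 z1 \<eta>2 z2)"
proof -
  have "pi\<^sup>2 \<le> 16" using pi_less_4 power_mono[of pi 4 2] by auto
  then have "pi\<^sup>2 * (\<bar>v1\<bar> * \<bar>v2\<bar>) \<le> 16 * (\<bar>v1\<bar> * \<bar>v2\<bar>)" by (intro mult_right_mono) auto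
  then have v: "\<bar>v1\<bar> * \<bar>v2\<bar> \<le> 16 * (rho z1 \<eta>1 * rho z2 \<eta>2)"
    by (simp add: rho_eq field_simps power2_eq_square)
  have "\<bar>v1\<bar> * \<bar>v2\<bar> / den \<le> 16 * (rho z1 \<eta>1 * rho z2 \<eta>2) / (gamma_hat \<eta>1 z1 \<eta>2 z2 / 10 ^ 6)"
    using v gamma_hat_pos gamma_hat_le den_pos by (intro frac_le) (auto simp: rho_eq)
  also have "\<dots> = 16 * 10 ^ 6 * (rho z1 \<eta>1 * rho z2 \<eta>2 / gamma_hat \<eta>1 z1 \<eta>2 z2)" by simp
  also have "\<dots> \<le> 10 ^ 8 * (rho z1 \<eta>1 * rho z2 \<eta>2 / gamma_hat \<eta>1 z1 \<eta>2 z2)"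
    using gamma_hat_pos by (intro mult_right_mono) (auto simp: rho_eq)
  finally show ?thesis .
qed

end

theorem lemma3p3:
  fixes K :: real
  shows "\<exists>C::real. \<forall>n::nat. n \<ge> 1 \<longrightarrow>
    (\<forall>A1 \<in> carrier_mat (2 * n) (2 * n). \<forall>A2 \<in> carrier_mat (2 * n) (2 * n).
      op_norm A1 \<le> K \<longrightarrow> op_norm A2 \<le> K \<longrightarrow>
      (\<forall>(z1::complex) (z2::complex) (\<eta>1::real) (\<eta>2::real).
        cmod z1 < 10 \<longrightarrow> cmod z2 < 10 \<longrightarrow>
        0 < \<bar>\<eta>1\<bar> \<longrightarrow> \<bar>\<eta>1\<bar> < 10 \<longrightarrow> 0 < \<bar>\<eta>2\<bar> \<longrightarrow> \<bar>\<eta>2\<bar> < 10 \<longrightarrow>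
          op_norm (M12 n (\<i> * of_real \<eta>1) z1 (\<i> * of_real \<eta>2) z2 A1)
            \<le> C * (1 / gamma_ctrl \<eta>1 z1 \<eta>2 z2)
        \<and> cmod (ntrace n (M12_hat n \<eta>1 z1 \<eta>2 z2 A1 * A2))
            \<le> C * (rho z1 \<eta>1 * rho z2 \<eta>2 / gamma_hat \<eta>1 z1 \<eta>2 z2)
        \<and> op_norm (M121 n (\<i> * of_real \<eta>1) z1 (\<i> * of_real \<eta>2) z2 A1 A2)
            \<le> C * (1 / (min \<bar>\<eta>1\<bar> \<bar>\<eta>2\<bar> * gamma_ctrl \<eta>1 z1 \<eta>2 z2))))"
proof -
  \<comment> \<open>Adding 1 ensures \<open>a \<le> a\<^sup>2\<close>, so one constant serves all
    three bounds. \<open>C\<close> depends on \<open>K\<close> alone; its \<open>10 ^ 68\<close> is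
    \<open>10 ^ 60\<close> from \<open>M121\<close> times \<open>10 ^ 8\<close> from the comparison
    of control parameters.\<close>
  define a where "a = 1 + \<bar>K\<bar>"
  have a: "1 \<le> a" "K \<le> a" by (auto simp: a_def)
  have aa: "a \<le> a\<^sup>2" "0 \<le> a\<^sup>2" using a by (simp_all add: power2_eq_square)
  define C where "C = 10 ^ 68 * a\<^sup>2"
  show ?thesis
  proof (intro exI[of _ C] allI impI ballI)
    fix n :: nat and A1 A2 :: "complex mat" and z1 z2 :: complex and \<eta>1 \<eta>2 :: real
    assume n: "n \<ge> 1" and A: "A1 \<in> cmat n" "A2 \<in> cmat n" and K: "op_norm A1 \<le> K" "op_norm A2 \<le> K"
      and z: "cmod z1 < 10" "cmod z2 < 10"
      and \<eta>: "0 < \<bar>\<eta>1\<bar>" "\<bar>\<eta>1\<bar> < 10" "0 < \<bar>\<eta>2\<bar>" "\<bar>\<eta>2\<bar> < 10"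
    obtain v1 u1 where d1: "m_data z1 \<eta>1 v1 u1" using m_data_exists[of \<eta>1] \<eta> by auto
    obtain v2 u2 where d2: "m_data z2 \<eta>2 v2 u2" using m_data_exists[of \<eta>2] \<eta> by auto
    interpret m_pair z1 z2 \<eta>1 \<eta>2 v1 v2 u1 u2
      using d1 d2 z \<eta> by unfold_locales
    have K': "op_norm A1 \<le> a" "op_norm A2 \<le> a" using K a by auto
    let ?g = "1 / gamma_ctrl \<eta>1 z1 \<eta>2 z2" and ?r = "rho z1 \<eta>1 * rho z2 \<eta>2 / gamma_hat \<eta>1 z1 \<eta>2 z2"
    have R0: "0 \<le> num / den" using num_pos den_pos by simp
    moreover have "0 \<le> 10 ^ 8 * ?g" using R0 num_div_den_le by (rule order_trans)
    ultimately have R: "0 \<le> num / den" "num / den \<le> 10 ^ 8 * ?g" "0 \<le> ?g"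
      using num_div_den_le by (simp_all add: zero_le_mult_iff)
    have r: "0 \<le> ?r" using gamma_hat_pos by (simp add: rho_eq)
    have "op_norm (M12 n (\<i> * of_real \<eta>1) z1 (\<i> * of_real \<eta>2) z2 A1) \<le> 10 ^ 19 * a * (num / den)"
      by (rule op_norm_M12_le[OF n A(1) K'(1)])
    also have "\<dots> \<le> 10 ^ 60 * a\<^sup>2 * (10 ^ 8 * ?g)"
      using a aa R by (intro mult_mono) auto
    finally have 1: "op_norm (M12 n (\<i> * of_real \<eta>1) z1 (\<i> * of_real \<eta>2) z2 A1) \<le> C * ?g"
      by (simp add: C_def)
    have "cmod (ntrace n (M12_hat n \<eta>1 z1 \<eta>2 z2 A1 * A2)) \<le> 10 ^ 19 * a\<^sup>2 * (\<bar>v1\<bar> * \<bar>v2\<bar> / den)"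
      by (rule M12_hat_bound[OF n A(1) K'(1) A(2) K'(2) a(1)])
    also have "\<dots> \<le> 10 ^ 60 * a\<^sup>2 * (10 ^ 8 * ?r)"
      using aa r vv_div_den_le den_pos by (intro mult_mono) auto
    finally have 2: "cmod (ntrace n (M12_hat n \<eta>1 z1 \<eta>2 z2 A1 * A2)) \<le> C * ?r"
      by (simp add: C_def)
    have "op_norm (M121 n (\<i> * of_real \<eta>1) z1 (\<i> * of_real \<eta>2) z2 A1 A2) \<le> 10 ^ 60 * a\<^sup>2 * (num / den) / \<eta>min"
      by (rule op_norm_M121_le[OF n A(1) K'(1) A(2) K'(2) a(1)])
    also have "\<dots> \<le> 10 ^ 60 * a\<^sup>2 * (10 ^ 8 * ?g) / \<eta>min"
      using aa R \<eta> by (intro divide_right_mono mult_left_mono) auto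
    also have "\<dots> = C * (1 / (\<eta>min * gamma_ctrl \<eta>1 z1 \<eta>2 z2))"
      by (simp add: C_def)
    finally show "op_norm (M12 n (\<i> * of_real \<eta>1) z1 (\<i> * of_real \<eta>2) z2 A1) \<le> C * ?g
        \<and> cmod (ntrace n (M12_hat n \<eta>1 z1 \<eta>2 z2 A1 * A2)) \<le> C * ?r
        \<and> op_norm (M121 n (\<i> * of_real \<eta>1) z1 (\<i> * of_real \<eta>2) z2 A1 A2)
            \<le> C * (1 / (\<eta>min * gamma_ctrl \<eta>1 z1 \<eta>2 z2))"
      using 1 2 by simp
  qed
qed

end
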